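(* The boxes (as objects) and wiring diagrams (as morphisms), with the identities and the composition described in the context, form a category $\mathbf{W}$; and the monoidal product $\oplus$ together with the closed box $0=(\varnothing,\varnothing)$ as unit makes $(\mathbf{W},\oplus,0)$ a symmetric monoidal category.
   Context: $\mathbf{Man}$ denotes a small category equivalent to the category of second-countable smooth manifolds and smooth maps. **Typed finite sets.** $\mathbf{TFS}$ is the category whose objects (typed finite sets) are pairs $(A,\tau)$ with $A$ a finite set and $\tau\colon A\to \mathrm{Ob}\,\mathbf{Man}$ a function, and whose morphisms $(A,\tau)\to(A',\tau')$ (typed functions) are functions $q\colon A\to A'$ with $\tau'\circ q=\tau$. A typed bijection is a bijective typed function. $\mathbf{TFS}$ has finite coproducts, denoted $+$ (disjoint union with the induced typing); $\nabla\colon A+A\to A$ is the codiagonal, and $\mathbb{1}_A$ is the identity. **Boxes.** A box is an ordered pair $X=(X^{\mathrm{in}},X^{\mathrm{out}})$ of typed finite sets. **Wiring diagrams.** A wiring diagram $\Phi\colon X\to Y$ is a triple $(X,Y,\varphi)$ where $\varphi\colon X^{\mathrm{in}}+Y^{\mathrm{out}}\xrightarrow{\cong}X^{\mathrm{out}}+Y^{\mathrm{in}}$ is a typed bijection satisfying the "no passing wires" condition $\varphi(Y^{\mathrm{out}})\subseteq X^{\mathrm{out}}$ (equivalently $\varphi(Y^{\mathrm{out}})\cap Y^{\mathrm{in}}=\varnothing$). Thus $\varphi$ is equivalently a pair of typed functions $\varphi^{\mathrm{in}}\colon X^{\mathrm{in}}\to X^{\mathrm{out}}+Y^{\mathrm{in}}$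 and $\varphi^{\mathrm{out}}\colon Y^{\mathrm{out}}\to X^{\mathrm{out}}$ (the restrictions of $\varphi$). **Identity.** The identity wiring diagram $X\to X$ is given by the identity map of $X^{\mathrm{in}}+X^{\mathrm{out}}$, i.e. $\iota^{\mathrm{in}}\colon X^{\mathrm{in}}\to X^{\mathrm{out}}+X^{\mathrm{in}}$ is the coproduct inclusion and $\iota^{\mathrm{out}}=\mathbb{1}_{X^{\mathrm{out}}}$. **Composition.** For $\Phi=(X,Y,\varphi)$ and $\Psi=(Y,Z,\psi)$, $\Psi\circ\Phi=(X,Z,\omega)$ where $\omega^{\mathrm{out}}=\varphi^{\mathrm{out}}\circ\psi^{\mathrm{out}}\colon Z^{\mathrm{out}}\to X^{\mathrm{out}}$ and $\omega^{\mathrm{in}}$ is the composite $$X^{\mathrm{in}}\xrightarrow{\varphi^{\mathrm{in}}}X^{\mathrm{out}}+Y^{\mathrm{in}}\xrightarrow{\mathbb{1}+\psi^{\mathrm{in}}}X^{\mathrm{out}}+Y^{\mathrm{out}}+Z^{\mathrm{in}}\xrightarrow{\mathbb{1}+\varphi^{\mathrm{out}}+\mathbb{1}}X^{\mathrm{out}}+X^{\mathrm{out}}+Z^{\mathrm{in}}\xrightarrow{\nabla+\mathbb{1}}X^{\mathrm{out}}+Z^{\mathrm{in}}.$$ **Monoidal product.** For boxes $X_1,X_2$, $X_1\oplus X_2:=(X_1^{\mathrm{in}}+X_2^{\mathrm{in}},\,X_1^{\mathrm{out}}+X_2^{\mathrm{out}})$. For wiring diagrams $\Phi_1=(X_1,Y_1,\varphi_1)$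 and $\Phi_2=(X_2,Y_2,\varphi_2)$, $\Phi_1\oplus\Phi_2\colon X_1\oplus X_2\to Y_1\oplus Y_2$ is given by the coproduct $\varphi_1+\varphi_2$ (after the canonical rearrangement of summands). The unit is the closed box $0=(\varnothing,\varnothing)$. The associativity, unit and symmetry isomorphisms are those induced by the canonical isomorphisms of finite coproducts in $\mathbf{TFS}$. *)

theory Defs
  imports "HOL-Analysis.Analysis"
begin

section \<open>Categories\<close>

record ('o, 'f) cat =
  Obj :: "'o set"
  Arr :: "'f set"
  Dom :: "'f \<Rightarrow> 'o"
  Cod :: "'f \<Rightarrow> 'o"
  Ident :: "'o \<Rightarrow> 'f"
  Comp :: "'f \<Rightarrow> 'f \<Rightarrow> 'f"

definition Hom :: "('o, 'f, 'z) cat_scheme \<Rightarrow> 'o \<Rightarrow> 'o \<Rightarrow> 'f set" where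
  "Hom C A B = {f \<in> Arr C. Dom C f = A \<and> Cod C f = B}"

text \<open>\<^term>\<open>Comp C g f\<close> is \<open>g \<circ> f\<close>; its value is constrained only for composable arrows.\<close>

locale category =
  fixes C :: "('o, 'f) cat"
  assumes dom_in_Obj: "f \<in> Arr C \<Longrightarrow> Dom C f \<in> Obj C"
    and cod_in_Obj: "f \<in> Arr C \<Longrightarrow> Cod C f \<in> Obj C"
    and ident_in_Hom: "A \<in> Obj C \<Longrightarrow> Ident C A \<in> Hom C A A"
    and comp_in_Hom: "\<lbrakk>f \<in> Hom C A B; g \<in> Hom C B D\<rbrakk> \<Longrightarrow> Comp C g f \<in> Hom C A D"
    and comp_ident_right: "f \<in> Hom C A B \<Longrightarrow> Comp C f (Ident C A) = f"
    and comp_ident_left: "f \<in> Hom C A B \<Longrightarrow> Comp C (Ident C B) f = f"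
    and comp_assoc: "\<lbrakk>f \<in> Hom C A B; g \<in> Hom C B D; h \<in> Hom C D E\<rbrakk>
          \<Longrightarrow> Comp C h (Comp C g f) = Comp C (Comp C h g) f"

definition is_iso :: "('o, 'f) cat \<Rightarrow> 'f \<Rightarrow> bool" where
  "is_iso C f \<longleftrightarrow> f \<in> Arr C \<and>
     (\<exists>g \<in> Hom C (Cod C f) (Dom C f).
        Comp C g f = Ident C (Dom C f) \<and> Comp C f g = Ident C (Cod C f))"

definition prod_cat :: "('o, 'f) cat \<Rightarrow> ('p, 'g) cat \<Rightarrow> ('o \<times> 'p, 'f \<times> 'g) cat" where
  "prod_cat C D =
     \<lparr> Obj = Obj C \<times> Obj D,
       Arr = Arr C \<times> Arr D,
       Dom = map_prod (Dom C) (Dom D),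
       Cod = map_prod (Cod C) (Cod D),
       Ident = map_prod (Ident C) (Ident D),
       Comp = (\<lambda>(g, g') (f, f'). (Comp C g f, Comp D g' f')) \<rparr>"

definition is_functor ::
    "('o, 'f) cat \<Rightarrow> ('p, 'g) cat \<Rightarrow> ('o \<Rightarrow> 'p) \<Rightarrow> ('f \<Rightarrow> 'g) \<Rightarrow> bool" where
  "is_functor C D Fo Fa \<longleftrightarrow> category C \<and> category D \<and>
     (\<forall>A \<in> Obj C. Fo A \<in> Obj D \<and> Fa (Ident C A) = Ident D (Fo A)) \<and>
     (\<forall>f \<in> Arr C. Fa f \<in> Hom D (Fo (Dom C f)) (Fo (Cod C f))) \<and>
     (\<forall>f \<in> Arr C. \<forall>g \<in> Arr C. Cod C f = Dom C g \<longrightarrow> Fa (Comp C g f) = Comp D (Fa g) (Fa f))"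

definition is_natural_iso ::
    "('o, 'f) cat \<Rightarrow> ('p, 'g) cat \<Rightarrow> ('o \<Rightarrow> 'p) \<Rightarrow> ('f \<Rightarrow> 'g) \<Rightarrow>
     ('o \<Rightarrow> 'p) \<Rightarrow> ('f \<Rightarrow> 'g) \<Rightarrow> ('o \<Rightarrow> 'g) \<Rightarrow> bool" where
  "is_natural_iso C D Fo Fa Go Ga \<eta> \<longleftrightarrow>
     is_functor C D Fo Fa \<and> is_functor C D Go Ga \<and>
     (\<forall>A \<in> Obj C. \<eta> A \<in> Hom D (Fo A) (Go A) \<and> is_iso D (\<eta> A)) \<and>
     (\<forall>f \<in> Arr C. Comp D (\<eta> (Cod C f)) (Fa f) = Comp D (Ga f) (\<eta> (Dom C f)))"

definition equivalent_categories :: "('o, 'f) cat \<Rightarrow> ('p, 'g) cat \<Rightarrow> bool" where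
  "equivalent_categories C D \<longleftrightarrow>
     (\<exists>Fo Fa Go Ga \<eta> \<epsilon>.
        is_functor C D Fo Fa \<and> is_functor D C Go Ga \<and>
        is_natural_iso C C (\<lambda>A. A) (\<lambda>f. f) (Go \<circ> Fo) (Ga \<circ> Fa) \<eta> \<and>
        is_natural_iso D D (Fo \<circ> Go) (Fa \<circ> Ga) (\<lambda>A. A) (\<lambda>f. f) \<epsilon>)"


section \<open>Symmetric monoidal categories\<close>

record ('o, 'f) monoidal_structure =
  TensorO :: "'o \<Rightarrow> 'o \<Rightarrow> 'o"
  TensorA :: "'f \<Rightarrow> 'f \<Rightarrow> 'f"
  UnitO :: "'o"
  Assoc :: "'o \<Rightarrow> 'o \<Rightarrow> 'o \<Rightarrow> 'f"
  LUnit :: "'o \<Rightarrow> 'f"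
  RUnit :: "'o \<Rightarrow> 'f"
  Braid :: "'o \<Rightarrow> 'o \<Rightarrow> 'f"

text \<open>
  Directions: \<open>Assoc A B D : (A \<otimes> B) \<otimes> D \<rightarrow> A \<otimes> (B \<otimes> D)\<close>, \<open>LUnit A : I \<otimes> A \<rightarrow> A\<close>,
  \<open>RUnit A : A \<otimes> I \<rightarrow> A\<close>, \<open>Braid A B : A \<otimes> B \<rightarrow> B \<otimes> A\<close>.
\<close>

locale symmetric_monoidal_category = category C
  for C :: "('o, 'f) cat" +
  fixes M :: "('o, 'f) monoidal_structure"
  assumes tensor_functor:
      "is_functor (prod_cat C C) C
         (\<lambda>(A, B). TensorO M A B) (\<lambda>(f, g). TensorA M f g)"
    and unit_in_Obj: "UnitO M \<in> Obj C"
    and assoc_natural_iso: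
      "is_natural_iso (prod_cat C (prod_cat C C)) C
         (\<lambda>(A, B, D). TensorO M (TensorO M A B) D)
         (\<lambda>(f, g, h). TensorA M (TensorA M f g) h)
         (\<lambda>(A, B, D). TensorO M A (TensorO M B D))
         (\<lambda>(f, g, h). TensorA M f (TensorA M g h))
         (\<lambda>(A, B, D). Assoc M A B D)"
    and lunit_natural_iso:
      "is_natural_iso C C
         (\<lambda>A. TensorO M (UnitO M) A) (\<lambda>f. TensorA M (Ident C (UnitO M)) f)
         (\<lambda>A. A) (\<lambda>f. f) (LUnit M)"
    and runit_natural_iso:
      "is_natural_iso C C
         (\<lambda>A. TensorO M A (UnitO M)) (\<lambda>f. TensorA M f (Ident C (UnitO M)))
         (\<lambda>A. A) (\<lambda>f. f) (RUnit M)"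
    and braid_natural_iso:
      "is_natural_iso (prod_cat C C) C
         (\<lambda>(A, B). TensorO M A B) (\<lambda>(f, g). TensorA M f g)
         (\<lambda>(A, B). TensorO M B A) (\<lambda>(f, g). TensorA M g f)
         (\<lambda>(A, B). Braid M A B)"
    and pentagon:
      "\<lbrakk>A \<in> Obj C; B \<in> Obj C; D \<in> Obj C; E \<in> Obj C\<rbrakk> \<Longrightarrow>
         Comp C (Assoc M A B (TensorO M D E)) (Assoc M (TensorO M A B) D E) =
         Comp C (TensorA M (Ident C A) (Assoc M B D E))
           (Comp C (Assoc M A (TensorO M B D) E) (TensorA M (Assoc M A B D) (Ident C E)))"
    and triangle:
      "\<lbrakk>A \<in> Obj C; B \<in> Obj C\<rbrakk> \<Longrightarrow>
         Comp C (TensorA M (Ident C A) (LUnit M B)) (Assoc M A (UnitO M) B) =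
         TensorA M (RUnit M A) (Ident C B)"
    and hexagon:
      "\<lbrakk>A \<in> Obj C; B \<in> Obj C; D \<in> Obj C\<rbrakk> \<Longrightarrow>
         Comp C (Assoc M B D A) (Comp C (Braid M A (TensorO M B D)) (Assoc M A B D)) =
         Comp C (TensorA M (Ident C B) (Braid M A D))
           (Comp C (Assoc M B A D) (TensorA M (Braid M A B) (Ident C D)))"
    and symmetry:
      "\<lbrakk>A \<in> Obj C; B \<in> Obj C\<rbrakk> \<Longrightarrow>
         Comp C (Braid M B A) (Braid M A B) = Ident C (TensorO M A B)"


section \<open>The category of second-countable smooth manifolds\<close>

text \<open>
  \<open>R\<^sup>n\<close> is the library's \<^term>\<open>Euclidean_space n\<close>: sequences vanishing from index \<open>n\<close> on.
  Below, \<open>U\<close> is always open in it, so for \<open>i < n\<close> the line \<open>t \<mapsto> x(i := t)\<close> stays in \<open>U\<close> near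
  \<open>t = x i\<close>, and values of the functions outside \<open>U\<close> are irrelevant.
\<close>

definition partial_deriv :: "nat \<Rightarrow> ((nat \<Rightarrow> real) \<Rightarrow> real) \<Rightarrow> (nat \<Rightarrow> real) \<Rightarrow> real" where
  "partial_deriv i f x = deriv (\<lambda>t. f (x(i := t))) (x i)"

primrec Ck_on :: "nat \<Rightarrow> nat \<Rightarrow> (nat \<Rightarrow> real) set \<Rightarrow> ((nat \<Rightarrow> real) \<Rightarrow> real) \<Rightarrow> bool" where
  "Ck_on n 0 U f \<longleftrightarrow> continuous_map (subtopology (Euclidean_space n) U) euclideanreal f"
| "Ck_on n (Suc k) U f \<longleftrightarrow>
     continuous_map (subtopology (Euclidean_space n) U) euclideanreal f \<and>
     (\<forall>i<n. (\<forall>x\<in>U. (\<lambda>t. f (x(i := t))) field_differentiable at (x i)) \<and>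
            Ck_on n k U (partial_deriv i f))"

definition smooth_on ::
    "nat \<Rightarrow> nat \<Rightarrow> (nat \<Rightarrow> real) set \<Rightarrow> ((nat \<Rightarrow> real) \<Rightarrow> (nat \<Rightarrow> real)) \<Rightarrow> bool" where
  "smooth_on n m U f \<longleftrightarrow>
     f ` U \<subseteq> topspace (Euclidean_space m) \<and> (\<forall>j<m. \<forall>k. Ck_on n k U (\<lambda>x. f x j))"

text \<open>
  The points of a manifold are taken from \<^typ>\<open>real\<close>. A second-countable manifold has at most
  continuum many points, so every one is diffeomorphic to one of this form, and the
  category \<open>SmoothMan\<close> below is equivalent to the category of all of them.
\<close>

type_synonym chart = "real set \<times> (real \<Rightarrow> nat \<Rightarrow> real)"

record manifold =
  mdim :: nat
  mtop :: "real topology"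
  atlas :: "chart set"

text \<open>
  Chart maps, like arrows below, are normalised by \<^const>\<open>extensional\<close>, so that equality of
  HOL functions is equality of maps on the carrier.
\<close>

definition is_chart :: "nat \<Rightarrow> real topology \<Rightarrow> chart \<Rightarrow> bool" where
  "is_chart n X = (\<lambda>(U, \<phi>).
     openin X U \<and> \<phi> \<in> extensional U \<and> openin (Euclidean_space n) (\<phi> ` U) \<and>
     homeomorphic_map (subtopology X U) (subtopology (Euclidean_space n) (\<phi> ` U)) \<phi>)"

definition smoothly_compatible :: "nat \<Rightarrow> chart \<Rightarrow> chart \<Rightarrow> bool" where
  "smoothly_compatible n = (\<lambda>(U, \<phi>) (V, \<psi>).
     smooth_on n n (\<phi> ` (U \<inter> V)) (\<psi> \<circ> inv_into U \<phi>) \<and>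
     smooth_on n n (\<psi> ` (U \<inter> V)) (\<phi> \<circ> inv_into V \<psi>))"

definition smooth_manifold :: "manifold \<Rightarrow> bool" where
  "smooth_manifold N \<longleftrightarrow>
     Hausdorff_space (mtop N) \<and> second_countable (mtop N) \<and>
     (\<forall>c \<in> atlas N. is_chart (mdim N) (mtop N) c) \<and>
     \<Union> (fst ` atlas N) = topspace (mtop N) \<and>
     (\<forall>c \<in> atlas N. \<forall>d \<in> atlas N. smoothly_compatible (mdim N) c d) \<and>
     (\<forall>c. is_chart (mdim N) (mtop N) c \<and>
          (\<forall>d \<in> atlas N. smoothly_compatible (mdim N) c d) \<longrightarrow> c \<in> atlas N)"

definition smooth_map :: "manifold \<Rightarrow> manifold \<Rightarrow> (real \<Rightarrow> real) \<Rightarrow> bool" where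
  "smooth_map N P f \<longleftrightarrow>
     continuous_map (mtop N) (mtop P) f \<and>
     (\<forall>(U, \<phi>) \<in> atlas N. \<forall>(V, \<psi>) \<in> atlas P.
        smooth_on (mdim N) (mdim P) (\<phi> ` (U \<inter> f -` V)) (\<psi> \<circ> f \<circ> inv_into U \<phi>))"

definition SmoothMan :: "(manifold, manifold \<times> manifold \<times> (real \<Rightarrow> real)) cat" where
  "SmoothMan =
     \<lparr> Obj = {N. smooth_manifold N},
       Arr = {(N, P, f). smooth_manifold N \<and> smooth_manifold P \<and>
                f \<in> extensional (topspace (mtop N)) \<and> smooth_map N P f},
       Dom = (\<lambda>(N, P, f). N),
       Cod = (\<lambda>(N, P, f). P),
       Ident = (\<lambda>N. (N, N, restrict id (topspace (mtop N)))),
       Comp = (\<lambda>(P, Q, g) (N, P', f). (N, Q, compose (topspace (mtop N)) g f)) \<rparr>"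

definition is_Man :: "('m, 'f) cat \<Rightarrow> bool" where
  "is_Man C \<longleftrightarrow> category C \<and> equivalent_categories C SmoothMan"


section \<open>Typed finite sets\<close>

text \<open>
  The elements of typed finite sets are drawn from a universe over arbitrary atoms that is
  closed under two tags, so that the tagged disjoint union of two sets lies in the same
  universe. Nothing is identified: \<open>(A + B) + C\<close> and \<open>A + (B + C)\<close> are different sets.
\<close>

datatype 'a elem = Atom 'a | InL (un_InL: "'a elem") | InR "'a elem"

type_synonym ('a, 'm) tfs = "'a elem set \<times> ('a elem \<Rightarrow> 'm)"

definition typed_finite_set :: "('m, 'f) cat \<Rightarrow> ('a, 'm) tfs \<Rightarrow> bool" where
  "typed_finite_set Man = (\<lambda>(A, \<tau>). finite A \<and> \<tau> \<in> A \<rightarrow>\<^sub>E Obj Man)"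

definition typed_function :: "('a, 'm) tfs \<Rightarrow> ('a, 'm) tfs \<Rightarrow> ('a elem \<Rightarrow> 'a elem) \<Rightarrow> bool" where
  "typed_function = (\<lambda>(A, \<tau>) (A', \<tau>') q. q \<in> A \<rightarrow>\<^sub>E A' \<and> (\<forall>a \<in> A. \<tau>' (q a) = \<tau> a))"

definition typed_bijection :: "('a, 'm) tfs \<Rightarrow> ('a, 'm) tfs \<Rightarrow> ('a elem \<Rightarrow> 'a elem) \<Rightarrow> bool" where
  "typed_bijection S T q \<longleftrightarrow> typed_function S T q \<and> bij_betw q (fst S) (fst T)"

text \<open>
  The canonical maps of coproducts are given by formulas on the whole universe and are restricted
  to the relevant carrier when a wiring diagram is formed.
\<close>

definition copair :: "('a elem \<Rightarrow> 'b) \<Rightarrow> ('a elem \<Rightarrow> 'b) \<Rightarrow> 'a elem \<Rightarrow> 'b" where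
  "copair f g e = (case e of InL x \<Rightarrow> f x | InR y \<Rightarrow> g y)"

definition map_coprod ::
    "('a elem \<Rightarrow> 'a elem) \<Rightarrow> ('a elem \<Rightarrow> 'a elem) \<Rightarrow> 'a elem \<Rightarrow> 'a elem" (infixr "[+]" 65) where
  "f [+] g = copair (InL \<circ> f) (InR \<circ> g)"

definition codiag :: "'a elem \<Rightarrow> 'a elem" where
  "codiag = copair id id"

text \<open>\<open>(A + B) + C \<rightarrow> A + (B + C)\<close>, its inverse, \<open>A + B \<rightarrow> B + A\<close>,
  and \<open>(A + B) + (C + D) \<rightarrow> (A + C) + (B + D)\<close>\<close>

definition coassoc :: "'a elem \<Rightarrow> 'a elem" where
  "coassoc = copair (copair InL (InR \<circ> InL)) (InR \<circ> InR)"

definition coassoc_inv :: "'a elem \<Rightarrow> 'a elem" where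
  "coassoc_inv = copair (InL \<circ> InL) (copair (InL \<circ> InR) InR)"

definition coswap :: "'a elem \<Rightarrow> 'a elem" where
  "coswap = copair InR InL"

definition interchange :: "'a elem \<Rightarrow> 'a elem" where
  "interchange = copair (copair (InL \<circ> InL) (InR \<circ> InL)) (copair (InL \<circ> InR) (InR \<circ> InR))"

definition tfs_sum :: "('a, 'm) tfs \<Rightarrow> ('a, 'm) tfs \<Rightarrow> ('a, 'm) tfs" (infixr "\<oplus>\<^sub>t" 65) where
  "S \<oplus>\<^sub>t T = (let A = InL ` fst S \<union> InR ` fst T in (A, restrict (copair (snd S) (snd T)) A))"

definition tfs_empty :: "('a, 'm) tfs" where
  "tfs_empty = ({}, restrict undefined {})"


section \<open>Boxes and wiring diagrams\<close>

type_synonym ('a, 'm) box = "('a, 'm) tfs \<times> ('a, 'm) tfs"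

abbreviation box_in :: "('a, 'm) box \<Rightarrow> ('a, 'm) tfs" where "box_in \<equiv> fst"
abbreviation box_out :: "('a, 'm) box \<Rightarrow> ('a, 'm) tfs" where "box_out \<equiv> snd"

definition is_box :: "('m, 'f) cat \<Rightarrow> ('a, 'm) box \<Rightarrow> bool" where
  "is_box Man X \<longleftrightarrow> typed_finite_set Man (box_in X) \<and> typed_finite_set Man (box_out X)"

type_synonym ('a, 'm) wd = "('a, 'm) box \<times> ('a, 'm) box \<times> ('a elem \<Rightarrow> 'a elem)"

definition wiring_diagram :: "('m, 'f) cat \<Rightarrow> ('a, 'm) wd \<Rightarrow> bool" where
  "wiring_diagram Man = (\<lambda>(X, Y, \<phi>).
     is_box Man X \<and> is_box Man Y \<and>
     typed_bijection (box_in X \<oplus>\<^sub>t box_out Y) (box_out X \<oplus>\<^sub>t box_in Y) \<phi> \<and>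
     \<phi> ` InR ` fst (box_out Y) \<subseteq> InL ` fst (box_out X))"

text \<open>The components \<open>\<phi>\<^sup>i\<^sup>n\<close> and \<open>\<phi>\<^sup>o\<^sup>u\<^sup>t\<close>; the latter drops the tag of \<open>X\<^sup>o\<^sup>u\<^sup>t\<close> in \<open>X\<^sup>o\<^sup>u\<^sup>t + Y\<^sup>i\<^sup>n\<close>.\<close>

definition wd_in :: "('a elem \<Rightarrow> 'a elem) \<Rightarrow> 'a elem \<Rightarrow> 'a elem" where
  "wd_in \<phi> = \<phi> \<circ> InL"

definition wd_out :: "('a elem \<Rightarrow> 'a elem) \<Rightarrow> 'a elem \<Rightarrow> 'a elem" where
  "wd_out \<phi> = un_InL \<circ> \<phi> \<circ> InR"

text \<open>The triple \<open>(X, Y, \<phi>)\<close> with given \<open>\<phi>\<^sup>i\<^sup>n : X\<^sup>i\<^sup>n \<rightarrow> X\<^sup>o\<^sup>u\<^sup>t + Y\<^sup>i\<^sup>n\<close> and \<open>\<phi>\<^sup>o\<^sup>u\<^sup>t : Y\<^sup>o\<^sup>u\<^sup>t \<rightarrow> X\<^sup>o\<^sup>u\<^sup>t\<close>\<close>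

definition mk_wd ::
    "('a, 'm) box \<Rightarrow> ('a, 'm) box \<Rightarrow> ('a elem \<Rightarrow> 'a elem) \<Rightarrow> ('a elem \<Rightarrow> 'a elem) \<Rightarrow> ('a, 'm) wd" where
  "mk_wd X Y f\<^sub>i f\<^sub>o = (X, Y, restrict (copair f\<^sub>i (InL \<circ> f\<^sub>o)) (fst (box_in X \<oplus>\<^sub>t box_out Y)))"

definition wd_id :: "('a, 'm) box \<Rightarrow> ('a, 'm) wd" where
  "wd_id X = mk_wd X X InR id"

definition wd_comp :: "('a, 'm) wd \<Rightarrow> ('a, 'm) wd \<Rightarrow> ('a, 'm) wd" where
  "wd_comp = (\<lambda>(Y, Z, \<psi>) (X, Y', \<phi>).
     mk_wd X Z
       ((codiag [+] id) \<circ> coassoc_inv \<circ> (id [+] (wd_out \<phi> [+] id)) \<circ> (id [+] wd_in \<psi>) \<circ> wd_in \<phi>)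
       (wd_out \<phi> \<circ> wd_out \<psi>))"

definition W :: "('m, 'f) cat \<Rightarrow> (('a, 'm) box, ('a, 'm) wd) cat" where
  "W Man =
     \<lparr> Obj = {X. is_box Man X},
       Arr = {\<Phi>. wiring_diagram Man \<Phi>},
       Dom = (\<lambda>(X, Y, \<phi>). X),
       Cod = (\<lambda>(X, Y, \<phi>). Y),
       Ident = wd_id,
       Comp = wd_comp \<rparr>"


section \<open>The monoidal structure\<close>

definition box_sum :: "('a, 'm) box \<Rightarrow> ('a, 'm) box \<Rightarrow> ('a, 'm) box" where
  "box_sum X Y = (box_in X \<oplus>\<^sub>t box_in Y, box_out X \<oplus>\<^sub>t box_out Y)"

definition closed_box :: "('a, 'm) box" where
  "closed_box = (tfs_empty, tfs_empty)"

definition wd_sum :: "('a, 'm) wd \<Rightarrow> ('a, 'm) wd \<Rightarrow> ('a, 'm) wd" where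
  "wd_sum = (\<lambda>(X\<^sub>1, Y\<^sub>1, \<phi>\<^sub>1) (X\<^sub>2, Y\<^sub>2, \<phi>\<^sub>2).
     let X = box_sum X\<^sub>1 X\<^sub>2; Y = box_sum Y\<^sub>1 Y\<^sub>2
     in (X, Y, restrict (interchange \<circ> (\<phi>\<^sub>1 [+] \<phi>\<^sub>2) \<circ> interchange) (fst (box_in X \<oplus>\<^sub>t box_out Y))))"

text \<open>
  The wiring diagram \<open>X \<rightarrow> Y\<close> induced by typed bijections \<open>e : X\<^sup>i\<^sup>n \<rightarrow> Y\<^sup>i\<^sup>n\<close> and \<open>d : Y\<^sup>o\<^sup>u\<^sup>t \<rightarrow> X\<^sup>o\<^sup>u\<^sup>t\<close>.
  Note that \<open>d\<close>, the component on outputs, runs backwards.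
\<close>

definition wd_of_bij ::
    "('a, 'm) box \<Rightarrow> ('a, 'm) box \<Rightarrow> ('a elem \<Rightarrow> 'a elem) \<Rightarrow> ('a elem \<Rightarrow> 'a elem) \<Rightarrow> ('a, 'm) wd" where
  "wd_of_bij X Y e d = mk_wd X Y (InR \<circ> e) d"

definition W_monoidal :: "(('a, 'm) box, ('a, 'm) wd) monoidal_structure" where
  "W_monoidal =
     \<lparr> TensorO = box_sum,
       TensorA = wd_sum,
       UnitO = closed_box,
       Assoc = (\<lambda>X Y Z. wd_of_bij (box_sum (box_sum X Y) Z) (box_sum X (box_sum Y Z))
                          coassoc coassoc_inv),
       LUnit = (\<lambda>X. wd_of_bij (box_sum closed_box X) X (copair undefined id) InR),
       RUnit = (\<lambda>X. wd_of_bij (box_sum X closed_box) X (copair id undefined) InL),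
       Braid = (\<lambda>X Y. wd_of_bij (box_sum X Y) (box_sum Y X) coswap coswap) \<rparr>"

end

theory Submission
  imports Defs
begin

text \<open>
  A wiring diagram is determined by its components \<open>\<phi>\<^sup>i\<^sup>n\<close> and \<open>\<phi>\<^sup>o\<^sup>u\<^sup>t\<close>, and in terms of these
  composition says: follow \<open>\<phi>\<^sup>i\<^sup>n\<close>; if the wire ends in \<open>Y\<^sup>i\<^sup>n\<close>, follow \<open>\<psi>\<^sup>i\<^sup>n\<close>; if it then ends in
  \<open>Y\<^sup>o\<^sup>u\<^sup>t\<close>, follow \<open>\<phi>\<^sup>o\<^sup>u\<^sup>t\<close>. Because there are no passing wires, the trace stops there, and it is
  again a bijection: tracing an element of \<open>Y\<^sup>i\<^sup>n\<close> backwards along \<open>\<phi>\<close> always leads to \<open>X\<^sup>i\<^sup>n\<close>.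
  A pair of typed bijections \<open>X\<^sup>i\<^sup>n \<rightarrow> Y\<^sup>i\<^sup>n\<close> and \<open>Y\<^sup>o\<^sup>u\<^sup>t \<rightarrow> X\<^sup>o\<^sup>u\<^sup>t\<close> induces an isomorphism of boxes,
  functorially and compatibly with sums, so the coherence diagrams in \<open>W\<close> reduce to identities
  between the canonical bijections of coproducts.
\<close>

section \<open>Evaluation of the canonical coproduct maps on tagged elements\<close>

lemma copair_simps [simp]:
  "copair f g (InL x) = f x" "copair f g (InR y) = g y"
  by (simp_all add: copair_def)

lemma map_coprod_simps [simp]:
  "(f [+] g) (InL x) = InL (f x)" "(f [+] g) (InR y) = InR (g y)"
  by (simp_all add: map_coprod_def)

lemma codiag_simps [simp]: "codiag (InL x) = x" "codiag (InR x) = x"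
  by (simp_all add: codiag_def)

lemma coassoc_simps [simp]:
  "coassoc (InL (InL x)) = InL x" "coassoc (InL (InR y)) = InR (InL y)" "coassoc (InR z) = InR (InR z)"
  "coassoc_inv (InL x) = InL (InL x)" "coassoc_inv (InR (InL y)) = InL (InR y)"
  "coassoc_inv (InR (InR z)) = InR z"
  by (simp_all add: coassoc_def coassoc_inv_def)

lemma coswap_simps [simp]: "coswap (InL x) = InR x" "coswap (InR x) = InL x"
  by (simp_all add: coswap_def)

lemma interchange_simps [simp]:
  "interchange (InL (InL x)) = InL (InL x)" "interchange (InL (InR x)) = InR (InL x)"
  "interchange (InR (InL x)) = InL (InR x)" "interchange (InR (InR x)) = InR (InR x)"
  by (simp_all add: interchange_def)

lemma tag_image_simps [simp]:
  "InL x \<in> InL ` S \<longleftrightarrow> x \<in> S" "InR x \<in> InR ` S \<longleftrightarrow> x \<in> S"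
  "InL x \<notin> InR ` S" "InR x \<notin> InL ` S"
  by auto

lemma fst_tfs_sum [simp]: "fst (S \<oplus>\<^sub>t T) = InL ` fst S \<union> InR ` fst T"
  by (simp add: tfs_sum_def Let_def)

lemma snd_tfs_sum [simp]:
  "a \<in> fst S \<Longrightarrow> snd (S \<oplus>\<^sub>t T) (InL a) = snd S a"
  "b \<in> fst T \<Longrightarrow> snd (S \<oplus>\<^sub>t T) (InR b) = snd T b"
  by (auto simp: tfs_sum_def Let_def)

lemma fst_tfs_empty [simp]: "fst tfs_empty = {}"
  by (simp add: tfs_empty_def)

lemma box_sum_simps [simp]:
  "box_in (box_sum X Y) = box_in X \<oplus>\<^sub>t box_in Y" "box_out (box_sum X Y) = box_out X \<oplus>\<^sub>t box_out Y"
  by (simp_all add: box_sum_def)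

lemma closed_box_simps [simp]: "box_in closed_box = tfs_empty" "box_out closed_box = tfs_empty"
  by (simp_all add: closed_box_def)

lemma typed_finite_set_sum:
  assumes "typed_finite_set Man S" "typed_finite_set Man T"
  shows "typed_finite_set Man (S \<oplus>\<^sub>t T)"
  using assms by (auto simp: typed_finite_set_def tfs_sum_def Let_def split: prod.splits)

lemma is_box_sum [simp]: "is_box Man X \<Longrightarrow> is_box Man Y \<Longrightarrow> is_box Man (box_sum X Y)"
  by (simp add: is_box_def typed_finite_set_sum)

lemma is_box_closed [simp]: "is_box Man closed_box"
  by (simp add: is_box_def typed_finite_set_def tfs_empty_def closed_box_def restrict_def)

section \<open>Wiring diagrams in terms of their two components\<close>

text \<open>Untagged values of \<open>f\<^sub>o\<close> in \<open>box_out X\<close> build in the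
  absence of passing wires; for the same reason surjectivity onto \<open>box_in Y\<close> is
  demanded of \<open>f\<^sub>i\<close> alone. Off the carriers both components are
  arbitrary.\<close>

definition wiring ::
    "('m, 'f) cat \<Rightarrow> ('a, 'm) box \<Rightarrow> ('a, 'm) box \<Rightarrow>
     ('a elem \<Rightarrow> 'a elem) \<Rightarrow> ('a elem \<Rightarrow> 'a elem) \<Rightarrow> bool" where
  "wiring Man X Y f\<^sub>i f\<^sub>o \<longleftrightarrow> is_box Man X \<and> is_box Man Y \<and>
     (\<forall>x \<in> fst (box_in X).
        (\<exists>a \<in> fst (box_out X). f\<^sub>i x = InL a \<and> snd (box_out X) a = snd (box_in X) x) \<or>
        (\<exists>b \<in> fst (box_in Y). f\<^sub>i x = InR b \<and> snd (box_in Y) b = snd (box_in X) x)) \<and>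
     (\<forall>y \<in> fst (box_out Y). f\<^sub>o y \<in> fst (box_out X) \<and> snd (box_out X) (f\<^sub>o y) = snd (box_out Y) y) \<and>
     inj_on f\<^sub>i (fst (box_in X)) \<and> inj_on f\<^sub>o (fst (box_out Y)) \<and>
     (\<forall>x \<in> fst (box_in X). \<forall>y \<in> fst (box_out Y). f\<^sub>i x \<noteq> InL (f\<^sub>o y)) \<and>
     (\<forall>a \<in> fst (box_out X). (\<exists>x \<in> fst (box_in X). f\<^sub>i x = InL a) \<or> (\<exists>y \<in> fst (box_out Y). f\<^sub>o y = a)) \<and>
     (\<forall>b \<in> fst (box_in Y). \<exists>x \<in> fst (box_in X). f\<^sub>i x = InR b)"

lemma wiring_in_cases :
  assumes "wiring Man X Y f\<^sub>i f\<^sub>o" "x \<in> fst (box_in X)"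
  obtains a where "a \<in> fst (box_out X)" "f\<^sub>i x = InL a" "snd (box_out X) a = snd (box_in X) x"
  | b where "b \<in> fst (box_in Y)" "f\<^sub>i x = InR b" "snd (box_in Y) b = snd (box_in X) x"
  using assms unfolding wiring_def by blast

lemma wiring_in_mem:
  assumes "wiring Man X Y f\<^sub>i f\<^sub>o" "x \<in> fst (box_in X)"
  shows "f\<^sub>i x \<in> InL ` fst (box_out X) \<union> InR ` fst (box_in Y)"
  using assms unfolding wiring_def by blast

lemma wiring_out:
  assumes "wiring Man X Y f\<^sub>i f\<^sub>o" "y \<in> fst (box_out Y)"
  shows "f\<^sub>o y \<in> fst (box_out X)" "snd (box_out X) (f\<^sub>o y) = snd (box_out Y) y"
  using assms unfolding wiring_def by blast+

lemma wiring_box: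
  assumes "wiring Man X Y f\<^sub>i f\<^sub>o"
  shows "is_box Man X" "is_box Man Y"
  using assms unfolding wiring_def by blast+

text \<open>Domain and codomain are tagged sums, so bijectivity of the glued map splits by tags into
  injectivity of each component, disjointness of the images and joint surjectivity, which are
  clauses of \<open>wiring\<close>.\<close>

lemma wiring_diagram_mk_wd: "wiring_diagram Man (mk_wd X Y f\<^sub>i f\<^sub>o)"
  if w: "wiring Man X Y f\<^sub>i f\<^sub>o"
proof -
  let ?f = "restrict (copair f\<^sub>i (InL \<circ> f\<^sub>o)) (fst (box_in X \<oplus>\<^sub>t box_out Y))"
  let ?D = "fst (box_in X \<oplus>\<^sub>t box_out Y)" and ?R = "fst (box_out X \<oplus>\<^sub>t box_in Y)"
  have t: "typed_function (box_in X \<oplus>\<^sub>t box_out Y) (box_out X \<oplus>\<^sub>t box_in Y) ?f"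
  proof -
    have "?f z \<in> ?R \<and> snd (box_out X \<oplus>\<^sub>t box_in Y) (?f z) = snd (box_in X \<oplus>\<^sub>t box_out Y) z"
      if z: "z \<in> ?D" for z
    proof -
      from z consider x where "x \<in> fst (box_in X)" "z = InL x" | y where "y \<in> fst (box_out Y)" "z = InR y"
        by auto
      then show ?thesis
      proof cases
        case (1 x)
        from 1(1) show ?thesis
          by (rule wiring_in_cases[OF w]) (use 1 in auto)
      qed (use wiring_out[OF w] in auto)
    qed
    then show ?thesis by (simp add: typed_function_def case_prod_beta PiE_iff)
  qed
  have "inj_on ?f ?D"
  proof -
    have i: "inj_on f\<^sub>i (fst (box_in X))" and o: "inj_on f\<^sub>o (fst (box_out Y))"
      and d: "\<And>x y. x \<in> fst (box_in X) \<Longrightarrow> y \<in> fst (box_out Y) \<Longrightarrow> f\<^sub>i x \<noteq> InL (f\<^sub>o y)"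
      using w unfolding wiring_def by blast+
    show ?thesis
      \<comment> \<open>Equal tags reduce to injectivity of one component; mixed tags contradict
        \<open>d\<close>, which is needed in both orientations.\<close>
      unfolding inj_on_def by (simp add: ball_Un inj_on_eq_iff[OF i] inj_on_eq_iff[OF o] d d[symmetric])
  qed
  moreover have "?R \<subseteq> ?f ` ?D"
  proof -
    have 1: "(\<exists>x \<in> fst (box_in X). f\<^sub>i x = InL a) \<or> (\<exists>y \<in> fst (box_out Y). f\<^sub>o y = a)"
      if "a \<in> fst (box_out X)" for a
      using w that unfolding wiring_def by blast
    have 2: "\<exists>x \<in> fst (box_in X). f\<^sub>i x = InR b" if "b \<in> fst (box_in Y)" for b
      using w that unfolding wiring_def by blast
    have "\<forall>r \<in> ?R. \<exists>z \<in> ?D. ?f z = r"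
      using 1 2 by (simp add: ball_Un bex_Un)
    then show ?thesis by (intro subsetI) (simp only: image_iff, metis)
  qed
  moreover have "?f ` ?D \<subseteq> ?R"
    using t unfolding typed_function_def case_prod_beta by blast
  ultimately have b: "bij_betw ?f ?D ?R"
    unfolding bij_betw_def by blast
  have "?f ` InR ` fst (box_out Y) \<subseteq> InL ` fst (box_out X)"
    by (auto simp: wiring_out[OF w])
  with t b show ?thesis
    using wiring_box[OF w] by (simp add: wiring_diagram_def mk_wd_def typed_bijection_def)
qed

text \<open>Lets statements about arrows be proved in components. The tag dropped by
  \<open>wd_out\<close> is always \<open>InL\<close>, as no wire passes, so it can be restored.
  Since \<open>\<phi>\<close> is extensional, gluing its components gives back the same function and
  not merely one that agrees on the carrier.\<close>

lemma wiring_diagram_cases: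
  assumes "wiring_diagram Man \<Phi>"
  obtains X Y f\<^sub>i f\<^sub>o where "\<Phi> = mk_wd X Y f\<^sub>i f\<^sub>o" "wiring Man X Y f\<^sub>i f\<^sub>o"
proof -
  obtain X Y \<phi> where \<Phi>: "\<Phi> = (X, Y, \<phi>)" by (cases \<Phi>)
  let ?D = "InL ` fst (box_in X) \<union> InR ` fst (box_out Y)"
  let ?R = "InL ` fst (box_out X) \<union> InR ` fst (box_in Y)"
  have box: "is_box Man X" "is_box Man Y"
    and ext: "\<phi> \<in> ?D \<rightarrow>\<^sub>E ?R"
    and ty: "\<And>a. a \<in> ?D \<Longrightarrow> snd (box_out X \<oplus>\<^sub>t box_in Y) (\<phi> a) = snd (box_in X \<oplus>\<^sub>t box_out Y) a"
    and bij: "bij_betw \<phi> ?D ?R"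
    and pass: "\<phi> ` InR ` fst (box_out Y) \<subseteq> InL ` fst (box_out X)"
    using assms by (auto simp: wiring_diagram_def \<Phi> typed_bijection_def typed_function_def case_prod_beta)
  have out: "\<phi> (InR y) = InL (wd_out \<phi> y)" "wd_out \<phi> y \<in> fst (box_out X)"
    if "y \<in> fst (box_out Y)" for y
    using pass that by (auto simp: wd_out_def image_subset_iff image_iff)
  have "mk_wd X Y (wd_in \<phi>) (wd_out \<phi>) = \<Phi>"
  proof -
    have "\<phi> = restrict \<phi> ?D" using ext by (simp add: PiE_restrict)
    also have "\<dots> = restrict (copair (wd_in \<phi>) (InL \<circ> wd_out \<phi>)) ?D"
      by (rule restrict_ext) (auto simp: wd_in_def out)
    finally show ?thesis by (simp add: mk_wd_def \<Phi>)
  qed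
  moreover have "wiring Man X Y (wd_in \<phi>) (wd_out \<phi>)"
    unfolding wiring_def
  proof (intro conjI ballI)
    fix x assume x: "x \<in> fst (box_in X)"
    show "(\<exists>a \<in> fst (box_out X). wd_in \<phi> x = InL a \<and> snd (box_out X) a = snd (box_in X) x) \<or>
        (\<exists>b \<in> fst (box_in Y). wd_in \<phi> x = InR b \<and> snd (box_in Y) b = snd (box_in X) x)"
    proof -
      have "\<phi> (InL x) \<in> ?R" using ext x by auto
      then show ?thesis using ty[of "InL x"] x by (auto simp: wd_in_def)
    qed
  next
    fix y assume y: "y \<in> fst (box_out Y)"
    then show "wd_out \<phi> y \<in> fst (box_out X)" by (rule out)
    show "snd (box_out X) (wd_out \<phi> y) = snd (box_out Y) y"
      using ty[of "InR y"] y out[OF y] by auto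
  next
    have inj: "inj_on \<phi> ?D" using bij by (simp add: bij_betw_def)
    note inj_iff = inj_on_eq_iff[OF inj]
    show "inj_on (wd_in \<phi>) (fst (box_in X))"
      by (rule inj_onI) (simp add: wd_in_def inj_iff)
    show "inj_on (wd_out \<phi>) (fst (box_out Y))"
    proof (rule inj_onI)
      fix y y' assume *: "y \<in> fst (box_out Y)" "y' \<in> fst (box_out Y)" "wd_out \<phi> y = wd_out \<phi> y'"
      then have "\<phi> (InR y) = \<phi> (InR y')" by (simp add: out)
      then show "y = y'" using * by (simp add: inj_iff)
    qed
    fix x y assume "x \<in> fst (box_in X)" "y \<in> fst (box_out Y)"
    then show "wd_in \<phi> x \<noteq> InL (wd_out \<phi> y)"
      by (simp add: wd_in_def out(1)[symmetric] inj_iff)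
  next
    fix a assume "a \<in> fst (box_out X)"
    then have "InL a \<in> \<phi> ` ?D" using bij by (auto simp: bij_betw_def)
    then show "(\<exists>x \<in> fst (box_in X). wd_in \<phi> x = InL a) \<or> (\<exists>y \<in> fst (box_out Y). wd_out \<phi> y = a)"
      by (auto simp: wd_in_def out)
  next
    fix b assume "b \<in> fst (box_in Y)"
    \<comment> \<open>A preimage tagged \<open>InR\<close> would be sent into the \<open>InL\<close>
      summand by \<open>out\<close>, so the preimage comes from \<open>box_in X\<close>.\<close>
    then have "InR b \<in> \<phi> ` ?D" using bij by (auto simp: bij_betw_def)
    then show "\<exists>x \<in> fst (box_in X). wd_in \<phi> x = InR b"
      by (auto simp: wd_in_def out)
  qed (use box in auto)
  ultimately show thesis using that by metis
qed

text \<open>The restriction in \<open>mk_wd\<close> discards everything off the carrier, so junk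
  values such as \<open>undefined\<close> in the unit isomorphisms are harmless. Most equations
  between arrows below are reduced to this pointwise check.\<close>

lemma mk_wd_eqI:
  assumes "\<And>x. x \<in> fst (box_in X) \<Longrightarrow> f\<^sub>i x = g\<^sub>i x"
    and "\<And>y. y \<in> fst (box_out Y) \<Longrightarrow> f\<^sub>o y = g\<^sub>o y"
  shows "mk_wd X Y f\<^sub>i f\<^sub>o = mk_wd X Y g\<^sub>i g\<^sub>o"
  using assms by (auto simp: mk_wd_def restrict_def fun_eq_iff)

section \<open>Composition in components\<close>

text \<open>The stages of the composite that follow \<open>f\<^sub>i\<close>, fused into one map
  from \<open>box_out X\<close> + \<open>box_in Y\<close> to \<open>box_out X\<close> +
  \<open>box_in Z\<close>.\<close>

definition comp_in :: "('a elem \<Rightarrow> 'a elem) \<Rightarrow> ('a elem \<Rightarrow> 'a elem) \<Rightarrow> 'a elem \<Rightarrow> 'a elem" where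
  "comp_in f\<^sub>o g\<^sub>i = copair InL (copair (InL \<circ> f\<^sub>o) InR \<circ> g\<^sub>i)"

lemma comp_in_simps [simp]:
  "comp_in f\<^sub>o g\<^sub>i (InL a) = InL a"
  "comp_in f\<^sub>o g\<^sub>i (InR b) = copair (InL \<circ> f\<^sub>o) InR (g\<^sub>i b)"
  by (simp_all add: comp_in_def)

lemma wd_comp_mk_wd:
  assumes f: "wiring Man X Y f\<^sub>i f\<^sub>o" and g: "wiring Man Y Z g\<^sub>i g\<^sub>o"
  shows "wd_comp (mk_wd Y Z g\<^sub>i g\<^sub>o) (mk_wd X Y f\<^sub>i f\<^sub>o) = mk_wd X Z (comp_in f\<^sub>o g\<^sub>i \<circ> f\<^sub>i) (f\<^sub>o \<circ> g\<^sub>o)"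
proof -
  have "wd_comp (mk_wd Y Z g\<^sub>i g\<^sub>o) (mk_wd X Y f\<^sub>i f\<^sub>o) =
    (let \<psi> = snd (snd (mk_wd Y Z g\<^sub>i g\<^sub>o)); \<phi> = snd (snd (mk_wd X Y f\<^sub>i f\<^sub>o)) in mk_wd X Z
       ((codiag [+] id) \<circ> coassoc_inv \<circ> (id [+] (wd_out \<phi> [+] id)) \<circ> (id [+] wd_in \<psi>) \<circ> wd_in \<phi>)
       (wd_out \<phi> \<circ> wd_out \<psi>))"
    by (simp add: wd_comp_def mk_wd_def)
  also have "\<dots> = mk_wd X Z (comp_in f\<^sub>o g\<^sub>i \<circ> f\<^sub>i) (f\<^sub>o \<circ> g\<^sub>o)"
    unfolding Let_def
  proof (rule mk_wd_eqI, goal_cases)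
    case (1 x)
    from 1 show ?case
    proof (rule wiring_in_cases[OF f], goal_cases)
      \<comment> \<open>The wire has reached \<open>box_in Y\<close>. Only the further split on
        \<open>g\<^sub>i b\<close> decides whether it returns to \<open>box_out X\<close> along
        \<open>f\<^sub>o\<close> or ends in \<open>box_in Z\<close>.\<close>
      case (2 b)
      from 2(1) show ?thesis
        by (rule wiring_in_cases[OF g]) (use 1 2 in \<open>simp_all add: mk_wd_def wd_in_def wd_out_def\<close>)
    qed (use 1 in \<open>simp add: mk_wd_def wd_in_def\<close>)
  qed (simp add: mk_wd_def wd_out_def wiring_out[OF g])
  finally show ?thesis .
qed

text \<open>Injectivity and disjointness follow by comparing the possible traces of a wire,
  surjectivity by tracing a wire backwards, first through the second diagram if necessary and then
  through the first.\<close>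

lemma wiring_comp:
  assumes f: "wiring Man X Y f\<^sub>i f\<^sub>o" and g: "wiring Man Y Z g\<^sub>i g\<^sub>o"
  shows "wiring Man X Z (comp_in f\<^sub>o g\<^sub>i \<circ> f\<^sub>i) (f\<^sub>o \<circ> g\<^sub>o)"
proof -
  let ?h = "comp_in f\<^sub>o g\<^sub>i \<circ> f\<^sub>i"
  \<comment> \<open>The three possible traces: stop at once in \<open>box_out X\<close>; go through
    \<open>box_in Y\<close> and \<open>box_out Y\<close> and return to \<open>box_out X\<close>; or
    go through \<open>box_in Y\<close> to \<open>box_in Z\<close>.\<close>
  have cases: thesis if "x \<in> fst (box_in X)"
    "\<And>a. \<lbrakk>a \<in> fst (box_out X); f\<^sub>i x = InL a; ?h x = InL a; snd (box_out X) a = snd (box_in X) x\<rbrakk> \<Longrightarrow> thesis"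
    "\<And>b c. \<lbrakk>b \<in> fst (box_in Y); f\<^sub>i x = InR b; c \<in> fst (box_out Y); g\<^sub>i b = InL c; ?h x = InL (f\<^sub>o c);
       f\<^sub>o c \<in> fst (box_out X); snd (box_out X) (f\<^sub>o c) = snd (box_in X) x\<rbrakk> \<Longrightarrow> thesis"
    "\<And>b c. \<lbrakk>b \<in> fst (box_in Y); f\<^sub>i x = InR b; c \<in> fst (box_in Z); g\<^sub>i b = InR c; ?h x = InR c;
       snd (box_in Z) c = snd (box_in X) x\<rbrakk> \<Longrightarrow> thesis"
    for x thesis
  proof (rule wiring_in_cases[OF f that(1)], goal_cases)
    case (1 a)
    then show ?thesis using that(2) by simp
  next
    case (2 b)
    from 2(1) show ?thesis
      by (rule wiring_in_cases[OF g]) (use 2 that(3,4) wiring_out[OF f] in auto)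
  qed
  note F = f[unfolded wiring_def] and G = g[unfolded wiring_def]
  have inj: "inj_on f\<^sub>i (fst (box_in X))" "inj_on f\<^sub>o (fst (box_out Y))"
    "inj_on g\<^sub>i (fst (box_in Y))" "inj_on g\<^sub>o (fst (box_out Z))"
    using F G by blast+
  have disj: "\<And>x y. x \<in> fst (box_in X) \<Longrightarrow> y \<in> fst (box_out Y) \<Longrightarrow> f\<^sub>i x \<noteq> InL (f\<^sub>o y)"
    "\<And>x y. x \<in> fst (box_in Y) \<Longrightarrow> y \<in> fst (box_out Z) \<Longrightarrow> g\<^sub>i x \<noteq> InL (g\<^sub>o y)"
    using F G by blast+
  show ?thesis
    unfolding wiring_def
  proof (intro conjI ballI)
    fix x assume "x \<in> fst (box_in X)"
    then show "(\<exists>a \<in> fst (box_out X). ?h x = InL a \<and> snd (box_out X) a = snd (box_in X) x) \<or>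
        (\<exists>b \<in> fst (box_in Z). ?h x = InR b \<and> snd (box_in Z) b = snd (box_in X) x)"
      by (rule cases) blast+
  next
    show "inj_on ?h (fst (box_in X))"
    proof (rule inj_onI)
      fix x x' assume x: "x \<in> fst (box_in X)" "x' \<in> fst (box_in X)" "?h x = ?h x'"
      have "f\<^sub>i x = f\<^sub>i x'"
      \<comment> \<open>Nine pairs of traces. If both wires return, \<open>f\<^sub>o\<close> is
        cancelled before \<open>g\<^sub>i\<close>; if both end in \<open>box_in Z\<close>, only
        \<open>g\<^sub>i\<close> is cancelled. A direct and a returning wire cannot end at the same
        point, because \<open>f\<^sub>i\<close> and \<open>f\<^sub>o\<close> have disjoint images;
        the other mixed pairs differ in their tags.\<close>
      proof (rule cases[OF x(1)]; rule cases[OF x(2)])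
        fix b c b' c' assume *: "b \<in> fst (box_in Y)" "b' \<in> fst (box_in Y)"
          "f\<^sub>i x = InR b" "f\<^sub>i x' = InR b'" "c \<in> fst (box_out Y)" "c' \<in> fst (box_out Y)"
          "g\<^sub>i b = InL c" "g\<^sub>i b' = InL c'" "?h x = InL (f\<^sub>o c)" "?h x' = InL (f\<^sub>o c')"
        then have "c = c'" using x(3) inj_on_eq_iff[OF inj(2)] by simp
        with * have "b = b'" using inj_on_eq_iff[OF inj(3)] by force
        then show ?thesis using * by simp
      next
        fix b c b' c' assume *: "b \<in> fst (box_in Y)" "b' \<in> fst (box_in Y)"
          "f\<^sub>i x = InR b" "f\<^sub>i x' = InR b'"
          "g\<^sub>i b = InR c" "g\<^sub>i b' = InR c'" "?h x = InR c" "?h x' = InR c'"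
        then have "b = b'" using x(3) inj_on_eq_iff[OF inj(3)] by force
        then show ?thesis using * by simp
      qed (use x disj(1) in \<open>force+\<close>)
      then show "x = x'" using x inj_on_eq_iff[OF inj(1)] by simp
    qed
  next
    show "inj_on (f\<^sub>o \<circ> g\<^sub>o) (fst (box_out Z))"
      using inj wiring_out[OF g] by (auto simp: inj_on_def)
  next
    fix x z assume x: "x \<in> fst (box_in X)" and z: "z \<in> fst (box_out Z)"
    \<comment> \<open>A direct wire is excluded by disjointness in the first diagram. For a
      returning wire, injectivity of \<open>f\<^sub>o\<close> reduces the equation to
      \<open>g\<^sub>i b = InL (g\<^sub>o z)\<close>, excluded by disjointness in the
      second.\<close>
    note gz = wiring_out(1)[OF g z]
    show "?h x \<noteq> InL ((f\<^sub>o \<circ> g\<^sub>o) z)"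
      by (rule cases[OF x]) (use disj x z gz inj_onD[OF inj(2)] in \<open>fastforce+\<close>)
  next
    fix a assume "a \<in> fst (box_out X)"
    then consider x where "x \<in> fst (box_in X)" "f\<^sub>i x = InL a"
      | y where "y \<in> fst (box_out Y)" "f\<^sub>o y = a"
      using F by blast
    then show "(\<exists>x \<in> fst (box_in X). ?h x = InL a) \<or> (\<exists>z \<in> fst (box_out Z). (f\<^sub>o \<circ> g\<^sub>o) z = a)"
    proof cases
      case 1
      then show ?thesis by (intro disjI1 bexI[of _ x]) auto
    next
      case 2
      \<comment> \<open>Here \<open>a\<close> is the image of an output \<open>y\<close> of the
        middle box. In the second diagram \<open>y\<close> is reached either from
        \<open>box_in Y\<close>, and hence from \<open>box_in X\<close>, or from
        \<open>box_out Z\<close>.\<close>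
      then consider b where "b \<in> fst (box_in Y)" "g\<^sub>i b = InL y" | z where "z \<in> fst (box_out Z)" "g\<^sub>o z = y"
        using G by blast
      then show ?thesis
      proof cases
        case 1
        then obtain x where "x \<in> fst (box_in X)" "f\<^sub>i x = InR b" using F by blast
        with 1 2 show ?thesis by (intro disjI1 bexI[of _ x]) auto
      qed (use 2 in auto)
    qed
  next
    fix c assume "c \<in> fst (box_in Z)"
    then obtain b where "b \<in> fst (box_in Y)" "g\<^sub>i b = InR c" using G by blast
    moreover from this obtain x where "x \<in> fst (box_in X)" "f\<^sub>i x = InR b" using F by blast
    ultimately show "\<exists>x \<in> fst (box_in X). ?h x = InR c" by (intro bexI[of _ x]) auto
  qed (use F G in auto)
qed

section \<open>Sums of wiring diagrams in components\<close>

definition sum_in :: "('a elem \<Rightarrow> 'a elem) \<Rightarrow> ('a elem \<Rightarrow> 'a elem) \<Rightarrow> 'a elem \<Rightarrow> 'a elem" where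
  "sum_in f g = copair ((InL [+] InL) \<circ> f) ((InR [+] InR) \<circ> g)"

lemma sum_in_simps [simp]:
  "sum_in f g (InL a) = (InL [+] InL) (f a)" "sum_in f g (InR b) = (InR [+] InR) (g b)"
  by (simp_all add: sum_in_def)

text \<open>On a tagged element \<open>u\<close>, \<open>interchange (InL u)\<close> is
  \<open>(InL [+] InL) u\<close>, and likewise with \<open>InR\<close>. This absorbs the outer
  rearrangement into \<open>sum_in\<close>; that values of \<open>f\<^sub>i\<close> and
  \<open>g\<^sub>i\<close> are tagged comes from \<open>wiring_in_mem\<close>.\<close>

lemma wd_sum_mk_wd:
  assumes f: "wiring Man X Y f\<^sub>i f\<^sub>o" and g: "wiring Man X' Y' g\<^sub>i g\<^sub>o"
  shows "wd_sum (mk_wd X Y f\<^sub>i f\<^sub>o) (mk_wd X' Y' g\<^sub>i g\<^sub>o) =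
    mk_wd (box_sum X X') (box_sum Y Y') (sum_in f\<^sub>i g\<^sub>i) (f\<^sub>o [+] g\<^sub>o)"
  using wiring_in_mem[OF f] wiring_in_mem[OF g]
  by (force simp: wd_sum_def mk_wd_def Let_def intro!: restrict_ext)

text \<open>Yields injectivity of \<open>sum_in\<close>. The memberships exclude atoms, on which
  \<open>copair\<close> has no branch and the maps take an unspecified value.\<close>

lemma tag_map_coprod_eq_iff:
  assumes "u \<in> InL ` S \<union> InR ` T" "v \<in> InL ` S' \<union> InR ` T'"
  shows "(InL [+] InL) u = (InL [+] InL) v \<longleftrightarrow> u = v" "(InR [+] InR) u = (InR [+] InR) v \<longleftrightarrow> u = v"
    "(InL [+] InL) u \<noteq> (InR [+] InR) v" "(InR [+] InR) v \<noteq> (InL [+] InL) u"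
  using assms by auto

text \<open>The two diagrams do not interact: the inner tag of each endpoint records which diagram a
  wire belongs to, so each clause is inherited summand by summand.\<close>

lemma wiring_sum:
  assumes f: "wiring Man X Y f\<^sub>i f\<^sub>o" and g: "wiring Man X' Y' g\<^sub>i g\<^sub>o"
  shows "wiring Man (box_sum X X') (box_sum Y Y') (sum_in f\<^sub>i g\<^sub>i) (f\<^sub>o [+] g\<^sub>o)"
proof -
  note F = f[unfolded wiring_def] and G = g[unfolded wiring_def]
  have inj: "inj_on f\<^sub>i (fst (box_in X))" "inj_on f\<^sub>o (fst (box_out Y))"
    "inj_on g\<^sub>i (fst (box_in X'))" "inj_on g\<^sub>o (fst (box_out Y'))"
    using F G by blast+
  have disj: "\<And>x y. x \<in> fst (box_in X) \<Longrightarrow> y \<in> fst (box_out Y) \<Longrightarrow> f\<^sub>i x \<noteq> InL (f\<^sub>o y)"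
    "\<And>x y. x \<in> fst (box_in X') \<Longrightarrow> y \<in> fst (box_out Y') \<Longrightarrow> g\<^sub>i x \<noteq> InL (g\<^sub>o y)"
    using F G by blast+
  let ?h = "sum_in f\<^sub>i g\<^sub>i" and ?k = "f\<^sub>o [+] g\<^sub>o"
  let ?X = "box_sum X X'" and ?Y = "box_sum Y Y'"
  have left: "(\<exists>a \<in> fst (box_out X). f\<^sub>i x = InL a \<and> ?h (InL x) = InL (InL a) \<and> snd (box_out X) a = snd (box_in X) x) \<or>
      (\<exists>b \<in> fst (box_in Y). f\<^sub>i x = InR b \<and> ?h (InL x) = InR (InL b) \<and> snd (box_in Y) b = snd (box_in X) x)"
    if "x \<in> fst (box_in X)" for x
    by (rule wiring_in_cases[OF f that]) auto
  have right: "(\<exists>a \<in> fst (box_out X'). g\<^sub>i x = InL a \<and> ?h (InR x) = InL (InR a) \<and> snd (box_out X') a = snd (box_in X') x) \<or>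
      (\<exists>b \<in> fst (box_in Y'). g\<^sub>i x = InR b \<and> ?h (InR x) = InR (InR b) \<and> snd (box_in Y') b = snd (box_in X') x)"
    if "x \<in> fst (box_in X')" for x
    by (rule wiring_in_cases[OF g that]) auto
  note mem = wiring_in_mem[OF f] wiring_in_mem[OF g]
  show ?thesis
    unfolding wiring_def
  proof (intro conjI)
    show "\<forall>x \<in> fst (box_in ?X).
        (\<exists>a \<in> fst (box_out ?X). ?h x = InL a \<and> snd (box_out ?X) a = snd (box_in ?X) x) \<or>
        (\<exists>b \<in> fst (box_in ?Y). ?h x = InR b \<and> snd (box_in ?Y) b = snd (box_in ?X) x)"
      using left right by (fastforce simp: ball_Un bex_Un)
  next
    show "\<forall>y \<in> fst (box_out ?Y). ?k y \<in> fst (box_out ?X) \<and> snd (box_out ?X) (?k y) = snd (box_out ?Y) y"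
      by (auto simp: wiring_out[OF f] wiring_out[OF g])
  next
    show "inj_on ?h (fst (box_in ?X))"
      unfolding inj_on_def
      by (simp add: ball_Un tag_map_coprod_eq_iff[OF mem(1) mem(1)]
          tag_map_coprod_eq_iff[OF mem(2) mem(2)] tag_map_coprod_eq_iff[OF mem(1) mem(2)] inj[THEN inj_on_eq_iff])
  next
    show "inj_on ?k (fst (box_out ?Y))"
      unfolding inj_on_def by (simp add: ball_Un inj[THEN inj_on_eq_iff])
  next
    show "\<forall>x \<in> fst (box_in ?X). \<forall>y \<in> fst (box_out ?Y). ?h x \<noteq> InL (?k y)"
    proof (intro ballI)
      fix x y assume "x \<in> fst (box_in ?X)" and y: "y \<in> fst (box_out ?Y)"
      then consider x' where "x' \<in> fst (box_in X)" "x = InL x'" | x' where "x' \<in> fst (box_in X')" "x = InR x'"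
        by auto
      then show "?h x \<noteq> InL (?k y)"
        by cases (use left right disj y in \<open>fastforce+\<close>)
    qed
  next
    have 1: "(\<exists>x \<in> fst (box_in X). f\<^sub>i x = InL a) \<or> (\<exists>y \<in> fst (box_out Y). f\<^sub>o y = a)"
      if "a \<in> fst (box_out X)" for a
      using F that by blast
    have 2: "(\<exists>x \<in> fst (box_in X'). g\<^sub>i x = InL a) \<or> (\<exists>y \<in> fst (box_out Y'). g\<^sub>o y = a)"
      if "a \<in> fst (box_out X')" for a
      using G that by blast
    show "\<forall>a \<in> fst (box_out ?X). (\<exists>x \<in> fst (box_in ?X). ?h x = InL a) \<or> (\<exists>y \<in> fst (box_out ?Y). ?k y = a)"
      unfolding box_sum_simps fst_tfs_sum ball_Un
    proof (intro conjI ballI; elim imageE; hypsubst)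
      fix a assume "a \<in> fst (box_out X)"
      from 1[OF this] show "(\<exists>x \<in> InL ` fst (box_in X) \<union> InR ` fst (box_in X'). ?h x = InL (InL a)) \<or>
        (\<exists>y \<in> InL ` fst (box_out Y) \<union> InR ` fst (box_out Y'). ?k y = InL a)"
        unfolding bex_Un by force
    next
      fix a assume "a \<in> fst (box_out X')"
      from 2[OF this] show "(\<exists>x \<in> InL ` fst (box_in X) \<union> InR ` fst (box_in X'). ?h x = InL (InR a)) \<or>
        (\<exists>y \<in> InL ` fst (box_out Y) \<union> InR ` fst (box_out Y'). ?k y = InR a)"
        unfolding bex_Un by force
    qed
  next
    have 1: "\<exists>x \<in> fst (box_in X). f\<^sub>i x = InR b" if "b \<in> fst (box_in Y)" for b
      using F that by blast
    have 2: "\<exists>x \<in> fst (box_in X'). g\<^sub>i x = InR b" if "b \<in> fst (box_in Y')" for b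
      using G that by blast
    show "\<forall>b \<in> fst (box_in ?Y). \<exists>x \<in> fst (box_in ?X). ?h x = InR b"
      unfolding box_sum_simps fst_tfs_sum ball_Un
    proof (intro conjI ballI; elim imageE; hypsubst)
      fix b assume "b \<in> fst (box_in Y)"
      from 1[OF this] show "\<exists>x \<in> InL ` fst (box_in X) \<union> InR ` fst (box_in X'). ?h x = InR (InL b)"
        unfolding bex_Un by force
    next
      fix b assume "b \<in> fst (box_in Y')"
      from 2[OF this] show "\<exists>x \<in> InL ` fst (box_in X) \<union> InR ` fst (box_in X'). ?h x = InR (InR b)"
        unfolding bex_Un by force
    qed
  qed (simp_all add: wiring_box[OF f] wiring_box[OF g])
qed

section \<open>The category of boxes and wiring diagrams\<close>

lemma W_simps [simp]:
  "Obj (W Man) = {X. is_box Man X}" "Arr (W Man) = {\<Phi>. wiring_diagram Man \<Phi>}"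
  "Ident (W Man) = wd_id" "Comp (W Man) = wd_comp"
  "Dom (W Man) (X, Y, \<phi>) = X" "Cod (W Man) (X, Y, \<phi>) = Y"
  by (simp_all add: W_def)

lemma Dom_Cod_mk_wd [simp]:
  "Dom (W Man) (mk_wd X Y f\<^sub>i f\<^sub>o) = X" "Cod (W Man) (mk_wd X Y f\<^sub>i f\<^sub>o) = Y"
  by (simp_all add: mk_wd_def)

lemma mk_wd_in_Hom: "wiring Man X Y f\<^sub>i f\<^sub>o \<Longrightarrow> mk_wd X Y f\<^sub>i f\<^sub>o \<in> Hom (W Man) X Y"
  by (simp add: Hom_def wiring_diagram_mk_wd)

lemma Hom_W_cases:
  assumes "\<Phi> \<in> Hom (W Man) X Y"
  obtains f\<^sub>i f\<^sub>o where "\<Phi> = mk_wd X Y f\<^sub>i f\<^sub>o" "wiring Man X Y f\<^sub>i f\<^sub>o"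
proof -
  have "wiring_diagram Man \<Phi>" "Dom (W Man) \<Phi> = X" "Cod (W Man) \<Phi> = Y"
    using assms by (auto simp: Hom_def)
  then show thesis
    by (elim wiring_diagram_cases) (auto intro: that)
qed

lemma wiring_id: "is_box Man X \<Longrightarrow> wiring Man X X InR id"
  by (auto simp: wiring_def inj_on_def)

lemma Hom_W_box:
  assumes "\<Phi> \<in> Hom (W Man) X Y"
  shows "is_box Man X" "is_box Man Y"
  using assms by (auto elim!: Hom_W_cases dest: wiring_box)

lemma wd_comp_in_Hom:
  "\<lbrakk>\<Phi> \<in> Hom (W Man) X Y; \<Psi> \<in> Hom (W Man) Y Z\<rbrakk> \<Longrightarrow> wd_comp \<Psi> \<Phi> \<in> Hom (W Man) X Z"
  by (elim Hom_W_cases) (simp add: wd_comp_mk_wd wiring_comp mk_wd_in_Hom)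

lemma category_W: "category (W Man :: (('a, 'm) box, ('a, 'm) wd) cat)"
proof
  show "Dom (W Man) \<Phi> \<in> Obj (W Man)" "Cod (W Man) \<Phi> \<in> Obj (W Man)"
    if "\<Phi> \<in> Arr (W Man)" for \<Phi> :: "('a, 'm) wd"
    using that Hom_W_box[of \<Phi> Man "Dom (W Man) \<Phi>" "Cod (W Man) \<Phi>"] by (simp_all add: Hom_def)
  show "Ident (W Man) X \<in> Hom (W Man) X X" if "X \<in> Obj (W Man)" for X :: "('a, 'm) box"
    using that by (simp add: wd_id_def mk_wd_in_Hom wiring_id)
next
  fix \<Phi> :: "('a, 'm) wd" and X Y assume "\<Phi> \<in> Hom (W Man) X Y"
  then obtain f\<^sub>i f\<^sub>o where \<Phi>: "\<Phi> = mk_wd X Y f\<^sub>i f\<^sub>o" and w: "wiring Man X Y f\<^sub>i f\<^sub>o"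
    by (rule Hom_W_cases)
  note box = wiring_box[OF w]
  \<comment> \<open>Composing with an identity applies to \<open>f\<^sub>i x\<close> a map that is
    the identity on tagged elements only; hence the appeal to \<open>wiring_in_mem\<close>, here and
    for the other unit law.\<close>
  show "Comp (W Man) \<Phi> (Ident (W Man) X) = \<Phi>"
    unfolding \<Phi> W_simps wd_id_def wd_comp_mk_wd[OF wiring_id[OF box(1)] w]
    by (rule mk_wd_eqI) (use wiring_in_mem[OF w] in force)+
  show "Comp (W Man) (Ident (W Man) Y) \<Phi> = \<Phi>"
    unfolding \<Phi> W_simps wd_id_def wd_comp_mk_wd[OF w wiring_id[OF box(2)]]
    by (rule mk_wd_eqI) (use wiring_in_mem[OF w] in force)+
next
  fix \<Phi> \<Psi> \<Theta> :: "('a, 'm) wd" and X Y Z V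
  assume "\<Phi> \<in> Hom (W Man) X Y" "\<Psi> \<in> Hom (W Man) Y Z" "\<Theta> \<in> Hom (W Man) Z V"
  then obtain f\<^sub>i f\<^sub>o g\<^sub>i g\<^sub>o h\<^sub>i h\<^sub>o where
    eq: "\<Phi> = mk_wd X Y f\<^sub>i f\<^sub>o" "\<Psi> = mk_wd Y Z g\<^sub>i g\<^sub>o" "\<Theta> = mk_wd Z V h\<^sub>i h\<^sub>o"
    and f: "wiring Man X Y f\<^sub>i f\<^sub>o" and g: "wiring Man Y Z g\<^sub>i g\<^sub>o" and h: "wiring Man Z V h\<^sub>i h\<^sub>o"
    by (elim Hom_W_cases)
  \<comment> \<open>Both bracketings are evaluated along the trace of \<open>x\<close>; a case split
    is made in the next diagram only if the wire enters it.\<close>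
  have "(comp_in (f\<^sub>o \<circ> g\<^sub>o) h\<^sub>i \<circ> (comp_in f\<^sub>o g\<^sub>i \<circ> f\<^sub>i)) x =
      (comp_in f\<^sub>o (comp_in g\<^sub>o h\<^sub>i \<circ> g\<^sub>i) \<circ> f\<^sub>i) x" if "x \<in> fst (box_in X)" for x
    using that
  proof (rule wiring_in_cases[OF f], goal_cases)
    case (2 b)
    from 2(1) show ?case
    proof (rule wiring_in_cases[OF g], goal_cases)
      case (2 c)
      from 2(1) show ?case
        by (rule wiring_in_cases[OF h]) (use 2 \<open>f\<^sub>i x = InR b\<close> in simp_all)
    qed (simp add: 2)
  qed simp
  then show "Comp (W Man) \<Theta> (Comp (W Man) \<Psi> \<Phi>) = Comp (W Man) (Comp (W Man) \<Theta> \<Psi>) \<Phi>"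
    unfolding eq W_simps wd_comp_mk_wd[OF f g] wd_comp_mk_wd[OF g h]
      wd_comp_mk_wd[OF wiring_comp[OF f g] h] wd_comp_mk_wd[OF f wiring_comp[OF g h]]
    by (intro mk_wd_eqI) auto
qed (simp add: wd_comp_in_Hom)

section \<open>Bifunctoriality of the sum\<close>

lemma wd_sum_in_Hom:
  assumes "\<Phi> \<in> Hom (W Man) X Y" "\<Psi> \<in> Hom (W Man) X' Y'"
  shows "wd_sum \<Phi> \<Psi> \<in> Hom (W Man) (box_sum X X') (box_sum Y Y')"
  using assms by (elim Hom_W_cases) (simp add: wd_sum_mk_wd wiring_sum mk_wd_in_Hom)

lemma wd_sum_id:
  assumes "is_box Man X" "is_box Man Y"
  shows "wd_sum (wd_id X) (wd_id Y) = wd_id (box_sum X Y)"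
  unfolding wd_id_def wd_sum_mk_wd[OF assms[THEN wiring_id]]
  by (rule mk_wd_eqI) auto

lemma wd_sum_comp:
  assumes "\<Phi> \<in> Hom (W Man) X Y" "\<Psi> \<in> Hom (W Man) Y Z" "\<Phi>' \<in> Hom (W Man) X' Y'" "\<Psi>' \<in> Hom (W Man) Y' Z'"
  shows "wd_sum (wd_comp \<Psi> \<Phi>) (wd_comp \<Psi>' \<Phi>') = wd_comp (wd_sum \<Psi> \<Psi>') (wd_sum \<Phi> \<Phi>')"
proof -
  obtain f\<^sub>i f\<^sub>o g\<^sub>i g\<^sub>o f\<^sub>i' f\<^sub>o' g\<^sub>i' g\<^sub>o' where
    eq: "\<Phi> = mk_wd X Y f\<^sub>i f\<^sub>o" "\<Psi> = mk_wd Y Z g\<^sub>i g\<^sub>o" "\<Phi>' = mk_wd X' Y' f\<^sub>i' f\<^sub>o'" "\<Psi>' = mk_wd Y' Z' g\<^sub>i' g\<^sub>o'"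
    and f: "wiring Man X Y f\<^sub>i f\<^sub>o" and g: "wiring Man Y Z g\<^sub>i g\<^sub>o"
    and f': "wiring Man X' Y' f\<^sub>i' f\<^sub>o'" and g': "wiring Man Y' Z' g\<^sub>i' g\<^sub>o'"
    using assms by (elim Hom_W_cases)
  \<comment> \<open>A trace that starts in the left summand stays there through both diagrams, so
    tagging commutes with composition; \<open>R\<close> is the mirror image.\<close>
  have L: "(InL [+] InL) (comp_in f\<^sub>o g\<^sub>i (f\<^sub>i x)) =
      comp_in (f\<^sub>o [+] f\<^sub>o') (sum_in g\<^sub>i g\<^sub>i') ((InL [+] InL) (f\<^sub>i x))" if "x \<in> fst (box_in X)" for x
    using that
  proof (rule wiring_in_cases[OF f], goal_cases)
    case (2 b)
    from 2(1) show ?case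
      by (rule wiring_in_cases[OF g]) (simp_all add: 2)
  qed simp
  have R: "(InR [+] InR) (comp_in f\<^sub>o' g\<^sub>i' (f\<^sub>i' x)) =
      comp_in (f\<^sub>o [+] f\<^sub>o') (sum_in g\<^sub>i g\<^sub>i') ((InR [+] InR) (f\<^sub>i' x))" if "x \<in> fst (box_in X')" for x
    using that
  proof (rule wiring_in_cases[OF f'], goal_cases)
    case (2 b)
    from 2(1) show ?case
      by (rule wiring_in_cases[OF g']) (simp_all add: 2)
  qed simp
  show ?thesis
    unfolding eq wd_comp_mk_wd[OF f g] wd_comp_mk_wd[OF f' g'] wd_sum_mk_wd[OF f f'] wd_sum_mk_wd[OF g g']
      wd_comp_mk_wd[OF wiring_sum[OF f f'] wiring_sum[OF g g']]
      wd_sum_mk_wd[OF wiring_comp[OF f g] wiring_comp[OF f' g']]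
    by (rule mk_wd_eqI) (auto simp: L R)
qed

section \<open>Isomorphisms of boxes induced by typed bijections\<close>

text \<open>Bijectivity is witnessed by an explicit inverse, so for the canonical maps it is
  verified by evaluation on tags.\<close>

definition typed_inverse ::
    "('a, 'm) tfs \<Rightarrow> ('a, 'm) tfs \<Rightarrow> ('a elem \<Rightarrow> 'a elem) \<Rightarrow> ('a elem \<Rightarrow> 'a elem) \<Rightarrow> bool" where
  "typed_inverse S T e e' \<longleftrightarrow>
     (\<forall>a \<in> fst S. e a \<in> fst T \<and> snd T (e a) = snd S a \<and> e' (e a) = a) \<and>
     (\<forall>b \<in> fst T. e' b \<in> fst S \<and> snd S (e' b) = snd T b \<and> e (e' b) = b)"

lemma typed_inverse_sym: "typed_inverse S T e e' \<Longrightarrow> typed_inverse T S e' e"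
  by (auto simp: typed_inverse_def)

lemma typed_inverse_id: "typed_inverse S S id id"
  by (simp add: typed_inverse_def)

lemma typed_inverse_coassoc: "typed_inverse ((S \<oplus>\<^sub>t T) \<oplus>\<^sub>t U) (S \<oplus>\<^sub>t (T \<oplus>\<^sub>t U)) coassoc coassoc_inv"
  by (auto simp: typed_inverse_def)

lemma typed_inverse_coswap: "typed_inverse (S \<oplus>\<^sub>t T) (T \<oplus>\<^sub>t S) coswap coswap"
  by (auto simp: typed_inverse_def)

text \<open>The \<open>undefined\<close> branch is never reached, because the left summand has empty
  carrier.\<close>

lemma typed_inverse_lunit: "typed_inverse (tfs_empty \<oplus>\<^sub>t S) S (copair undefined id) InR"
  by (auto simp: typed_inverse_def)

lemma typed_inverse_runit: "typed_inverse (S \<oplus>\<^sub>t tfs_empty) S (copair id undefined) InL"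
  by (auto simp: typed_inverse_def)

lemma typed_inverse_sum:
  "typed_inverse S T e e' \<Longrightarrow> typed_inverse S' T' d d' \<Longrightarrow>
    typed_inverse (S \<oplus>\<^sub>t S') (T \<oplus>\<^sub>t T') (e [+] d) (e' [+] d')"
  by (auto simp: typed_inverse_def)

lemma typed_inverse_comp:
  "typed_inverse S T p p' \<Longrightarrow> typed_inverse T U q q' \<Longrightarrow> typed_inverse S U (q \<circ> p) (p' \<circ> q')"
  by (simp add: typed_inverse_def)

definition box_iso ::
    "('m, 'f) cat \<Rightarrow> ('a, 'm) box \<Rightarrow> ('a, 'm) box \<Rightarrow> ('a elem \<Rightarrow> 'a elem) \<Rightarrow> ('a elem \<Rightarrow> 'a elem) \<Rightarrow> bool" where
  "box_iso Man X Y e d \<longleftrightarrow> is_box Man X \<and> is_box Man Y \<and>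
     (\<exists>e'. typed_inverse (box_in X) (box_in Y) e e') \<and> (\<exists>d'. typed_inverse (box_out Y) (box_out X) d d')"

text \<open>Inputs and outputs are independent here: \<open>e\<close> alone covers
  \<open>box_in Y\<close>, \<open>d\<close> alone covers \<open>box_out X\<close>, and the tags keep
  their images apart.\<close>

lemma wiring_box_iso:
  assumes "box_iso Man X Y e d"
  shows "wiring Man X Y (InR \<circ> e) d"
proof -
  obtain e' d' where e: "typed_inverse (box_in X) (box_in Y) e e'"
    and d: "typed_inverse (box_out Y) (box_out X) d d'" and b: "is_box Man X" "is_box Man Y"
    using assms by (auto simp: box_iso_def)
  have "inj_on (InR \<circ> e) (fst (box_in X))"
    \<comment> \<open>The left inverse first strips the tag \<open>InR\<close> and then undoes
      \<open>e\<close>.\<close>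
    by (rule inj_on_inverseI[of _ "e' \<circ> copair undefined id"]) (use e in \<open>simp add: typed_inverse_def\<close>)
  moreover have "inj_on d (fst (box_out Y))"
    by (rule inj_on_inverseI[of _ d']) (use d in \<open>simp add: typed_inverse_def\<close>)
  ultimately show ?thesis
    using e d b by (simp add: wiring_def typed_inverse_def) metis
qed

lemma wd_of_bij_in_Hom: "box_iso Man X Y e d \<Longrightarrow> wd_of_bij X Y e d \<in> Hom (W Man) X Y"
  by (simp add: wd_of_bij_def mk_wd_in_Hom wiring_box_iso)

lemma wd_of_bij_eqI:
  assumes "\<And>x. x \<in> fst (box_in X) \<Longrightarrow> e x = e' x" "\<And>y. y \<in> fst (box_out Y) \<Longrightarrow> d y = d' y"
  shows "wd_of_bij X Y e d = wd_of_bij X Y e' d'"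
  unfolding wd_of_bij_def by (rule mk_wd_eqI) (simp_all add: assms)

lemma wd_id_eq_wd_of_bij: "wd_id X = wd_of_bij X X id id"
  by (simp add: wd_id_def wd_of_bij_def)

lemma box_iso_id: "is_box Man X \<Longrightarrow> box_iso Man X X id id"
  by (auto simp: box_iso_def intro: typed_inverse_id)

lemma box_iso_comp:
  assumes "box_iso Man X Y e d" "box_iso Man Y Z e' d'"
  shows "box_iso Man X Z (e' \<circ> e) (d \<circ> d')"
  using assms unfolding box_iso_def by (auto intro: typed_inverse_comp)

lemma box_iso_sum:
  "box_iso Man X Y e d \<Longrightarrow> box_iso Man X' Y' e' d' \<Longrightarrow>
    box_iso Man (box_sum X X') (box_sum Y Y') (e [+] e') (d [+] d')"
  unfolding box_iso_def box_sum_simps by (blast intro: typed_inverse_sum is_box_sum)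

text \<open>No wire turns back in these diagrams, so composition is plain composition of maps, in
  reversed order on outputs. With the rule for sums, it turns coherence diagrams into equations
  between canonical maps.\<close>

lemma wd_comp_wd_of_bij:
  assumes "box_iso Man X Y e d" "box_iso Man Y Z e' d'"
  shows "wd_comp (wd_of_bij Y Z e' d') (wd_of_bij X Y e d) = wd_of_bij X Z (e' \<circ> e) (d \<circ> d')"
  unfolding wd_of_bij_def wd_comp_mk_wd[OF assms[THEN wiring_box_iso]]
  by (rule mk_wd_eqI) simp_all

lemma wd_sum_wd_of_bij:
  assumes "box_iso Man X Y e d" "box_iso Man X' Y' e' d'"
  shows "wd_sum (wd_of_bij X Y e d) (wd_of_bij X' Y' e' d') =
    wd_of_bij (box_sum X X') (box_sum Y Y') (e [+] e') (d [+] d')"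
  unfolding wd_of_bij_def wd_sum_mk_wd[OF assms[THEN wiring_box_iso]]
  by (rule mk_wd_eqI) auto

text \<open>The inverse arrow is induced by the inverses \<open>e'\<close> and \<open>d'\<close> of
  the two bijections.\<close>

lemma is_iso_wd_of_bij:
  assumes "box_iso Man X Y e d"
  shows "is_iso (W Man) (wd_of_bij X Y e d)"
proof -
  obtain e' d' where e: "typed_inverse (box_in X) (box_in Y) e e'"
    and d: "typed_inverse (box_out Y) (box_out X) d d'" and b: "is_box Man X" "is_box Man Y"
    using assms by (auto simp: box_iso_def)
  then have inv: "box_iso Man Y X e' d'"
    by (auto simp: box_iso_def intro: typed_inverse_sym)
  have "wd_comp (wd_of_bij Y X e' d') (wd_of_bij X Y e d) = wd_id X"
    unfolding wd_comp_wd_of_bij[OF assms inv] wd_id_eq_wd_of_bij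
    by (rule wd_of_bij_eqI) (use e d in \<open>simp_all add: typed_inverse_def\<close>)
  moreover have "wd_comp (wd_of_bij X Y e d) (wd_of_bij Y X e' d') = wd_id Y"
    unfolding wd_comp_wd_of_bij[OF inv assms] wd_id_eq_wd_of_bij
    by (rule wd_of_bij_eqI) (use e d in \<open>simp_all add: typed_inverse_def\<close>)
  moreover note wd_of_bij_in_Hom[OF assms] wd_of_bij_in_Hom[OF inv]
  ultimately show ?thesis
    unfolding is_iso_def Hom_def by fastforce
qed

text \<open>Reduces a naturality square in \<open>W\<close> to one equation in
  \<open>box_out X\<close> + \<open>box_in Y'\<close> and one on outputs, where \<open>d\<close> and
  \<open>d'\<close> run backwards.\<close>

lemma wd_of_bij_natural:
  assumes f: "wiring Man X Y f\<^sub>i f\<^sub>o" and g: "wiring Man X' Y' g\<^sub>i g\<^sub>o"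
    and e: "box_iso Man X X' e d" and e': "box_iso Man Y Y' e' d'"
    and in_eq: "\<And>x. x \<in> fst (box_in X) \<Longrightarrow> (id [+] e') (f\<^sub>i x) = (d [+] id) (g\<^sub>i (e x))"
    and out_eq: "\<And>y. y \<in> fst (box_out Y') \<Longrightarrow> f\<^sub>o (d' y) = d (g\<^sub>o y)"
  shows "wd_comp (wd_of_bij Y Y' e' d') (mk_wd X Y f\<^sub>i f\<^sub>o) = wd_comp (mk_wd X' Y' g\<^sub>i g\<^sub>o) (wd_of_bij X X' e d)"
  unfolding wd_of_bij_def wd_comp_mk_wd[OF f wiring_box_iso[OF e']] wd_comp_mk_wd[OF wiring_box_iso[OF e] g]
proof (rule mk_wd_eqI)
  fix x assume x: "x \<in> fst (box_in X)"
  then have "e x \<in> fst (box_in X')" using e by (auto simp: box_iso_def typed_inverse_def)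
  \<comment> \<open>Both \<open>f\<^sub>i x\<close> and \<open>g\<^sub>i (e x)\<close> are tagged,
    and on tagged elements the two composites act as \<open>id [+] e'\<close> and
    \<open>d [+] id\<close>, the maps in \<open>in_eq\<close>.\<close>
  with wiring_in_mem[OF f x] wiring_in_mem[OF g, of "e x"] in_eq[OF x]
  show "(comp_in f\<^sub>o (InR \<circ> e') \<circ> f\<^sub>i) x = (comp_in d g\<^sub>i \<circ> (InR \<circ> e)) x"
    by auto
qed (simp add: out_eq)

section \<open>Product categories and criteria for functors and natural isomorphisms\<close>

lemma Hom_prod_cat:
  "Hom (prod_cat C D) P Q = Hom C (fst P) (fst Q) \<times> Hom D (snd P) (snd Q)"
  by (auto simp: Hom_def prod_cat_def map_prod_def split: prod.splits)

lemma prod_cat_simps [simp]: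
  "Obj (prod_cat C D) = Obj C \<times> Obj D" "Arr (prod_cat C D) = Arr C \<times> Arr D"
  "Dom (prod_cat C D) (f, g) = (Dom C f, Dom D g)" "Cod (prod_cat C D) (f, g) = (Cod C f, Cod D g)"
  "Ident (prod_cat C D) (A, B) = (Ident C A, Ident D B)"
  "Comp (prod_cat C D) (h, k) (f, g) = (Comp C h f, Comp D k g)"
  by (simp_all add: prod_cat_def)

lemma category_prod_cat:
  assumes "category C" "category D"
  shows "category (prod_cat C D)"
proof -
  interpret C: category C by fact
  interpret D: category D by fact
  show ?thesis
    by unfold_locales
      (auto simp: Hom_prod_cat C.dom_in_Obj D.dom_in_Obj C.cod_in_Obj D.cod_in_Obj
        C.comp_ident_right D.comp_ident_right C.comp_ident_left D.comp_ident_left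
        intro: C.ident_in_Hom D.ident_in_Hom C.comp_in_Hom D.comp_in_Hom C.comp_assoc D.comp_assoc)
qed

lemma is_functorI:
  assumes "category C" "category D"
    and "\<And>A. A \<in> Obj C \<Longrightarrow> Fo A \<in> Obj D"
    and "\<And>A. A \<in> Obj C \<Longrightarrow> Fa (Ident C A) = Ident D (Fo A)"
    and "\<And>f A B. f \<in> Hom C A B \<Longrightarrow> Fa f \<in> Hom D (Fo A) (Fo B)"
    and "\<And>f g A B E. f \<in> Hom C A B \<Longrightarrow> g \<in> Hom C B E \<Longrightarrow> Fa (Comp C g f) = Comp D (Fa g) (Fa f)"
  shows "is_functor C D Fo Fa"
  using assms unfolding is_functor_def by (simp add: Hom_def)

lemma is_natural_isoI:
  assumes "is_functor C D Fo Fa" "is_functor C D Go Ga"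
    and "\<And>A. A \<in> Obj C \<Longrightarrow> \<eta> A \<in> Hom D (Fo A) (Go A)"
    and "\<And>A. A \<in> Obj C \<Longrightarrow> is_iso D (\<eta> A)"
    and "\<And>f A B. f \<in> Hom C A B \<Longrightarrow> Comp D (\<eta> B) (Fa f) = Comp D (Ga f) (\<eta> A)"
  shows "is_natural_iso C D Fo Fa Go Ga \<eta>"
  using assms unfolding is_natural_iso_def by (simp add: Hom_def)

lemma is_functor_id: "category C \<Longrightarrow> is_functor C C (\<lambda>A. A) (\<lambda>f. f)"
  by (rule is_functorI) (auto intro: category.ident_in_Hom)

lemma wd_id_in_Hom: "is_box Man X \<Longrightarrow> wd_id X \<in> Hom (W Man) X X"
  by (simp add: wd_id_def mk_wd_in_Hom wiring_id)

lemma wd_comp_id_id: "is_box Man X \<Longrightarrow> wd_comp (wd_id X) (wd_id X) = wd_id X"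
  using category.comp_ident_left[OF category_W wd_id_in_Hom] by simp

section \<open>The coherence isomorphisms\<close>

lemma box_iso_assoc:
  "\<lbrakk>is_box Man X; is_box Man Y; is_box Man Z\<rbrakk> \<Longrightarrow>
    box_iso Man (box_sum (box_sum X Y) Z) (box_sum X (box_sum Y Z)) coassoc coassoc_inv"
  unfolding box_iso_def box_sum_simps
  by (blast intro: is_box_sum typed_inverse_coassoc typed_inverse_sym)

lemma box_iso_lunit:
  "is_box Man X \<Longrightarrow> box_iso Man (box_sum closed_box X) X (copair undefined id) InR"
  unfolding box_iso_def box_sum_simps closed_box_simps
  by (blast intro: is_box_sum is_box_closed typed_inverse_lunit typed_inverse_sym)

lemma box_iso_runit:
  "is_box Man X \<Longrightarrow> box_iso Man (box_sum X closed_box) X (copair id undefined) InL"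
  unfolding box_iso_def box_sum_simps closed_box_simps
  by (blast intro: is_box_sum is_box_closed typed_inverse_runit typed_inverse_sym)

lemma box_iso_braid:
  "\<lbrakk>is_box Man X; is_box Man Y\<rbrakk> \<Longrightarrow> box_iso Man (box_sum X Y) (box_sum Y X) coswap coswap"
  unfolding box_iso_def box_sum_simps
  by (blast intro: is_box_sum typed_inverse_coswap)

text \<open>Meant for the three-arrow sides of the pentagon and the hexagon; the intermediate
  composite is shown to be a box isomorphism once and for all.\<close>

lemma wd_comp_wd_of_bij3:
  assumes "box_iso Man X Y e d" "box_iso Man Y Z e' d'" "box_iso Man Z V e'' d''"
  shows "wd_comp (wd_of_bij Z V e'' d'') (wd_comp (wd_of_bij Y Z e' d') (wd_of_bij X Y e d)) =
    wd_of_bij X V (e'' \<circ> e' \<circ> e) (d \<circ> d' \<circ> d'')"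
  using assms
  by (simp add: wd_comp_wd_of_bij[OF assms(1,2)]
      wd_comp_wd_of_bij[OF box_iso_comp[OF assms(1,2)] assms(3)] comp_assoc)

lemmas coherence_isos = box_iso_assoc box_iso_lunit box_iso_runit box_iso_braid
  box_iso_id box_iso_sum is_box_sum is_box_closed

lemma W_monoidal_simps [simp]:
  "TensorO W_monoidal = box_sum" "TensorA W_monoidal = wd_sum" "UnitO W_monoidal = closed_box"
  "Assoc W_monoidal X Y Z =
     wd_of_bij (box_sum (box_sum X Y) Z) (box_sum X (box_sum Y Z)) coassoc coassoc_inv"
  "LUnit W_monoidal X = wd_of_bij (box_sum closed_box X) X (copair undefined id) InR"
  "RUnit W_monoidal X = wd_of_bij (box_sum X closed_box) X (copair id undefined) InL"
  "Braid W_monoidal X Y = wd_of_bij (box_sum X Y) (box_sum Y X) coswap coswap"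
  by (simp_all add: W_monoidal_def)

section \<open>The symmetric monoidal structure\<close>

lemma symmetric_monoidal_category_W:
  "symmetric_monoidal_category (W Man :: (('a, 'm) box, ('a, 'm) wd) cat) W_monoidal"
proof -
  let ?W = "W Man :: (('a, 'm) box, ('a, 'm) wd) cat"
  let ?M = "W_monoidal :: (('a, 'm) box, ('a, 'm) wd) monoidal_structure"
  note cat = category_W[of Man] category_prod_cat[OF category_W category_W, of Man Man]
    category_prod_cat[OF category_W category_prod_cat[OF category_W category_W], of Man Man Man]
  have T: "is_functor (prod_cat ?W ?W) ?W (\<lambda>(A, B). box_sum A B) (\<lambda>(f, g). wd_sum f g)"
    by (rule is_functorI)
      (auto simp: cat Hom_prod_cat wd_sum_id[of Man] intro!: wd_sum_in_Hom wd_sum_comp)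
  have T': "is_functor (prod_cat ?W ?W) ?W (\<lambda>(A, B). box_sum B A) (\<lambda>(f, g). wd_sum g f)"
    by (rule is_functorI)
      (auto simp: cat Hom_prod_cat wd_sum_id[of Man] intro!: wd_sum_in_Hom wd_sum_comp)
  have TL: "is_functor (prod_cat ?W (prod_cat ?W ?W)) ?W
      (\<lambda>(A, B, D). box_sum (box_sum A B) D) (\<lambda>(f, g, h). wd_sum (wd_sum f g) h)"
    by (rule is_functorI)
      (auto simp: cat Hom_prod_cat wd_sum_id[of Man] wd_sum_comp[of _ Man] intro!: wd_sum_in_Hom wd_sum_comp)
  have TR: "is_functor (prod_cat ?W (prod_cat ?W ?W)) ?W
      (\<lambda>(A, B, D). box_sum A (box_sum B D)) (\<lambda>(f, g, h). wd_sum f (wd_sum g h))"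
    by (rule is_functorI)
      (auto simp: cat Hom_prod_cat wd_sum_id[of Man] wd_sum_comp[of _ Man] intro!: wd_sum_in_Hom wd_sum_comp)
  have unit_comp: "wd_comp (wd_id closed_box) (wd_id closed_box) = (wd_id closed_box :: ('a, 'm) wd)"
    by (rule wd_comp_id_id[OF is_box_closed])
  note unit_id = wd_id_in_Hom[OF is_box_closed, of Man]
  \<comment> \<open>Functoriality of tensoring with the unit is the interchange law with the
    identity of the closed box, composed with itself, in the other slot.\<close>
  have unit_sum_comp:
    "wd_sum (wd_id closed_box) (wd_comp g f) = wd_comp (wd_sum (wd_id closed_box) g) (wd_sum (wd_id closed_box) f)"
    "wd_sum (wd_comp g f) (wd_id closed_box) = wd_comp (wd_sum g (wd_id closed_box)) (wd_sum f (wd_id closed_box))"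
    if "f \<in> Hom ?W X Y" "g \<in> Hom ?W Y Z" for f g X Y Z
    using wd_sum_comp[OF unit_id unit_id that] wd_sum_comp[OF that unit_id unit_id]
    by (simp_all only: unit_comp)
  have TI: "is_functor ?W ?W (\<lambda>A. box_sum closed_box A) (\<lambda>f. wd_sum (wd_id closed_box) f)"
    by (rule is_functorI)
      (simp_all add: cat wd_sum_id[of Man] wd_sum_in_Hom unit_id unit_sum_comp)
  have IT: "is_functor ?W ?W (\<lambda>A. box_sum A closed_box) (\<lambda>f. wd_sum f (wd_id closed_box))"
    by (rule is_functorI)
      (simp_all add: cat wd_sum_id[of Man] wd_sum_in_Hom unit_id unit_sum_comp)
  have assoc_natural: "wd_comp (Assoc ?M A' B' D') (wd_sum (wd_sum f g) h) =
      wd_comp (wd_sum f (wd_sum g h)) (Assoc ?M A B D)"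
    if homs: "f \<in> Hom ?W A A'" "g \<in> Hom ?W B B'" "h \<in> Hom ?W D D'" for f g h A A' B B' D D'
  proof -
    obtain f\<^sub>i f\<^sub>o g\<^sub>i g\<^sub>o h\<^sub>i h\<^sub>o where eq: "f = mk_wd A A' f\<^sub>i f\<^sub>o" "g = mk_wd B B' g\<^sub>i g\<^sub>o" "h = mk_wd D D' h\<^sub>i h\<^sub>o"
      and f: "wiring Man A A' f\<^sub>i f\<^sub>o" and g: "wiring Man B B' g\<^sub>i g\<^sub>o" and h: "wiring Man D D' h\<^sub>i h\<^sub>o"
      using homs by (elim Hom_W_cases)
    note box = wiring_box[OF f] wiring_box[OF g] wiring_box[OF h]
    show ?thesis
      unfolding eq W_monoidal_simps wd_sum_mk_wd[OF f g] wd_sum_mk_wd[OF g h]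
        wd_sum_mk_wd[OF wiring_sum[OF f g] h] wd_sum_mk_wd[OF f wiring_sum[OF g h]]
    proof (rule wd_of_bij_natural[OF wiring_sum[OF wiring_sum[OF f g] h] wiring_sum[OF f wiring_sum[OF g h]]
          box_iso_assoc[OF box(1,3,5)] box_iso_assoc[OF box(2,4,6)]], goal_cases)
      case (1 x)
      \<comment> \<open>On each summand only one of the three diagrams acts; once the tag of its
        value is known, both sides evaluate to the same nested tag.\<close>
      then consider a where "a \<in> fst (box_in A)" "x = InL (InL a)"
        | b where "b \<in> fst (box_in B)" "x = InL (InR b)" | d where "d \<in> fst (box_in D)" "x = InR d"
        by auto
      then show ?case
        by cases (use wiring_in_mem[OF f] wiring_in_mem[OF g] wiring_in_mem[OF h] in fastforce)+
    qed auto
  qed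
  have braid_natural: "wd_comp (Braid ?M A' B') (wd_sum f g) = wd_comp (wd_sum g f) (Braid ?M A B)"
    if homs: "f \<in> Hom ?W A A'" "g \<in> Hom ?W B B'" for f g A A' B B'
  proof -
    obtain f\<^sub>i f\<^sub>o g\<^sub>i g\<^sub>o where eq: "f = mk_wd A A' f\<^sub>i f\<^sub>o" "g = mk_wd B B' g\<^sub>i g\<^sub>o"
      and f: "wiring Man A A' f\<^sub>i f\<^sub>o" and g: "wiring Man B B' g\<^sub>i g\<^sub>o"
      using homs by (elim Hom_W_cases)
    note box = wiring_box[OF f] wiring_box[OF g]
    show ?thesis
      unfolding eq W_monoidal_simps wd_sum_mk_wd[OF f g] wd_sum_mk_wd[OF g f]
    proof (rule wd_of_bij_natural[OF wiring_sum[OF f g] wiring_sum[OF g f]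
          box_iso_braid[OF box(1,3)] box_iso_braid[OF box(2,4)]], goal_cases)
      case (1 x)
      then consider a where "a \<in> fst (box_in A)" "x = InL a" | b where "b \<in> fst (box_in B)" "x = InR b"
        by auto
      then show ?case
        by cases (use wiring_in_mem[OF f] wiring_in_mem[OF g] in fastforce)+
    qed auto
  qed
  have lunit_natural: "wd_comp (LUnit ?M A') (wd_sum (wd_id closed_box) f) = wd_comp f (LUnit ?M A)"
    if hom: "f \<in> Hom ?W A A'" for f A A'
  proof -
    obtain f\<^sub>i f\<^sub>o where eq: "f = mk_wd A A' f\<^sub>i f\<^sub>o" and f: "wiring Man A A' f\<^sub>i f\<^sub>o"
      using hom by (elim Hom_W_cases)
    note unit = wiring_id[OF is_box_closed, of Man] and box = wiring_box[OF f]
    show ?thesis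
      unfolding eq W_monoidal_simps wd_id_def wd_sum_mk_wd[OF unit f]
      \<comment> \<open>The closed box has no inputs, so only points \<open>InR x\<close> occur, and
        on these the sum acts as \<open>f\<close>.\<close>
      by (rule wd_of_bij_natural[OF wiring_sum[OF unit f] f box_iso_lunit[OF box(1)] box_iso_lunit[OF box(2)]])
        (use wiring_in_mem[OF f] in fastforce)+
  qed
  have runit_natural: "wd_comp (RUnit ?M A') (wd_sum f (wd_id closed_box)) = wd_comp f (RUnit ?M A)"
    if hom: "f \<in> Hom ?W A A'" for f A A'
  proof -
    obtain f\<^sub>i f\<^sub>o where eq: "f = mk_wd A A' f\<^sub>i f\<^sub>o" and f: "wiring Man A A' f\<^sub>i f\<^sub>o"
      using hom by (elim Hom_W_cases)
    note unit = wiring_id[OF is_box_closed, of Man] and box = wiring_box[OF f]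
    show ?thesis
      unfolding eq W_monoidal_simps wd_id_def wd_sum_mk_wd[OF f unit]
      by (rule wd_of_bij_natural[OF wiring_sum[OF f unit] f box_iso_runit[OF box(1)] box_iso_runit[OF box(2)]])
        (use wiring_in_mem[OF f] in fastforce)+
  qed
  show ?thesis
  proof (intro symmetric_monoidal_category.intro symmetric_monoidal_category_axioms.intro)
    show "is_natural_iso (prod_cat ?W (prod_cat ?W ?W)) ?W
         (\<lambda>(A, B, D). TensorO ?M (TensorO ?M A B) D)
         (\<lambda>(f, g, h). TensorA ?M (TensorA ?M f g) h)
         (\<lambda>(A, B, D). TensorO ?M A (TensorO ?M B D))
         (\<lambda>(f, g, h). TensorA ?M f (TensorA ?M g h))
         (\<lambda>(A, B, D). Assoc ?M A B D)"
      unfolding W_monoidal_simps(1,2)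
      by (rule is_natural_isoI[OF TL TR])
        (auto simp: Hom_prod_cat assoc_natural[simplified] intro!: wd_of_bij_in_Hom is_iso_wd_of_bij box_iso_assoc)
    show "is_natural_iso ?W ?W
         (\<lambda>A. TensorO ?M (UnitO ?M) A) (\<lambda>f. TensorA ?M (Ident ?W (UnitO ?M)) f)
         (\<lambda>A. A) (\<lambda>f. f) (LUnit ?M)"
      unfolding W_monoidal_simps(1-3) W_simps(3)
      by (rule is_natural_isoI[OF TI is_functor_id[OF cat(1)]])
        (auto simp: lunit_natural[simplified] intro!: wd_of_bij_in_Hom is_iso_wd_of_bij box_iso_lunit)
    show "is_natural_iso ?W ?W
         (\<lambda>A. TensorO ?M A (UnitO ?M)) (\<lambda>f. TensorA ?M f (Ident ?W (UnitO ?M)))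
         (\<lambda>A. A) (\<lambda>f. f) (RUnit ?M)"
      unfolding W_monoidal_simps(1-3) W_simps(3)
      by (rule is_natural_isoI[OF IT is_functor_id[OF cat(1)]])
        (auto simp: runit_natural[simplified] intro!: wd_of_bij_in_Hom is_iso_wd_of_bij box_iso_runit)
    show "is_natural_iso (prod_cat ?W ?W) ?W
         (\<lambda>(A, B). TensorO ?M A B) (\<lambda>(f, g). TensorA ?M f g)
         (\<lambda>(A, B). TensorO ?M B A) (\<lambda>(f, g). TensorA ?M g f)
         (\<lambda>(A, B). Braid ?M A B)"
      unfolding W_monoidal_simps(1,2)
      by (rule is_natural_isoI[OF T T'])
        (auto simp: Hom_prod_cat braid_natural[simplified] intro!: wd_of_bij_in_Hom is_iso_wd_of_bij box_iso_braid)
  next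
    fix A B D E :: "('a, 'm) box"
    assume "A \<in> Obj ?W" "B \<in> Obj ?W" "D \<in> Obj ?W" "E \<in> Obj ?W"
    then have box: "is_box Man A" "is_box Man B" "is_box Man D" "is_box Man E" by simp_all
    show "Comp ?W (Assoc ?M A B (TensorO ?M D E)) (Assoc ?M (TensorO ?M A B) D E) =
         Comp ?W (TensorA ?M (Ident ?W A) (Assoc ?M B D E))
           (Comp ?W (Assoc ?M A (TensorO ?M B D) E) (TensorA ?M (Assoc ?M A B D) (Ident ?W E)))"
      \<comment> \<open>The three-arrow side is fused first, then the two-arrow side. What remains
        is an equality of rebracketing maps, checked on the four summands for inputs and, in the
        opposite direction, for outputs.\<close>
      by (simp add: wd_id_eq_wd_of_bij wd_sum_wd_of_bij[of Man] wd_comp_wd_of_bij3[of Man] coherence_isos box,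
          simp add: wd_comp_wd_of_bij[of Man] coherence_isos box)
        (rule wd_of_bij_eqI; auto)
  next
    fix A B :: "('a, 'm) box"
    assume "A \<in> Obj ?W" "B \<in> Obj ?W"
    then have box: "is_box Man A" "is_box Man B" by simp_all
    show "Comp ?W (TensorA ?M (Ident ?W A) (LUnit ?M B)) (Assoc ?M A (UnitO ?M) B) =
         TensorA ?M (RUnit ?M A) (Ident ?W B)"
      \<comment> \<open>The middle summand is empty, so the \<open>undefined\<close> branches of
        both unit isomorphisms are never met.\<close>
      by (simp add: wd_id_eq_wd_of_bij wd_sum_wd_of_bij[of Man] wd_comp_wd_of_bij[of Man] coherence_isos box)
        (rule wd_of_bij_eqI; auto)
  next
    fix A B D :: "('a, 'm) box"
    assume "A \<in> Obj ?W" "B \<in> Obj ?W" "D \<in> Obj ?W"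
    then have box: "is_box Man A" "is_box Man B" "is_box Man D" by simp_all
    show "Comp ?W (Assoc ?M B D A) (Comp ?W (Braid ?M A (TensorO ?M B D)) (Assoc ?M A B D)) =
         Comp ?W (TensorA ?M (Ident ?W B) (Braid ?M A D))
           (Comp ?W (Assoc ?M B A D) (TensorA ?M (Braid ?M A B) (Ident ?W D)))"
      \<comment> \<open>Both sides become one rearrangement of three summands, from (A + B) + D to B
        + (D + A) on inputs and backwards on outputs.\<close>
      by (simp add: wd_id_eq_wd_of_bij wd_sum_wd_of_bij[of Man] wd_comp_wd_of_bij3[of Man] coherence_isos box)
        (rule wd_of_bij_eqI; auto)
  next
    fix A B :: "('a, 'm) box"
    assume "A \<in> Obj ?W" "B \<in> Obj ?W"
    then have box: "is_box Man A" "is_box Man B" by simp_all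
    show "Comp ?W (Braid ?M B A) (Braid ?M A B) = Ident ?W (TensorO ?M A B)"
      by (simp add: wd_id_eq_wd_of_bij wd_comp_wd_of_bij[of Man] coherence_isos box)
        (rule wd_of_bij_eqI; auto)
  qed (use cat T in simp_all)
qed

theorem proposition3p11:
  fixes Man :: "('m, 'f) cat"
  assumes "is_Man Man"
  shows "category (W Man :: (('a, 'm) box, ('a, 'm) wd) cat) \<and>
         symmetric_monoidal_category (W Man :: (('a, 'm) box, ('a, 'm) wd) cat) W_monoidal"
  by (simp add: category_W symmetric_monoidal_category_W)

end
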